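(* Let $f$, $M$, $l_f$, $L_M$ satisfy A1) and A2), let $x_0\in\mathbb{R}^d$, and let $0=t_0<t_1<\dots<t_N=T$ be a grid with step-sizes $h_n=t_{n+1}-t_n$ satisfying A3). Let $C$, $P$, $\Gamma$ be as in the context and $|\boldsymbol{h}|_\infty:=\max_{0\le n\le N-1}h_n$. Then for every sequence $\{y_n\}_{n=0}^N$ with $y_0=x_0$ and $y_{n+1}\in\Phi(t_n,y_n;h_n)$ for $n=0,\dots,N-1$, there exists a solution $x(\cdot)$ of the differential inclusion $\dot x(t)\in f(t,x(t))+M(t,x(t))$, $t\in[0,T]$, $x(0)=x_0$, such that $$|x(t_n)-y_n|\le\int_0^{t_n}e^{\int_t^{t_n}(l_f(s)+L_M(s))\,ds}\,\Gamma(|\boldsymbol{h}|_\infty,t)\,dt$$ for $n=0,\dots,N$.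
   Context: $|\cdot|$ is the Euclidean norm on $\mathbb{R}^d$, $\|A\|=\sup_{a\in A}|a|$, $B_C(0)$ is the closed ball of radius $C$. For nonempty compact $A,B\subset\mathbb{R}^d$, $\operatorname{dist}(A,B)=\sup_{a\in A}\inf_{b\in B}|a-b|$ and $\operatorname{dist}_H(A,B)=\max\{\operatorname{dist}(A,B),\operatorname{dist}(B,A)\}$. Let $T>0$. A1) $f:[0,T]\times\mathbb{R}^d\to\mathbb{R}^d$ is continuous and there is a continuous function $l_f:[0,T]\to\mathbb{R}$ such that $\langle f(t,x)-f(t,x'),x-x'\rangle\le l_f(t)|x-x'|^2$ for all $t\in[0,T]$, $x,x'\in\mathbb{R}^d$. A2) $M:[0,T]\times\mathbb{R}^d\to\{\text{nonempty convex compact subsets of }\mathbb{R}^d\}$ is continuous with respect to the Hausdorff metric and there is a continuous function $L_M:[0,T]\to[0,\infty)$ such that $\operatorname{dist}_H(M(t,x),M(t,x'))\le L_M(t)|x-x'|$ for all $t\in[0,T]$, $x,x'\in\mathbb{R}^d$. A3) $l_f(t_{n+1})h_n<1$ for all $n\in\{0,\dots,N-1\}$. A solution of the differential inclusion is an absolutely continuous function $x:[0,T]\to\mathbb{R}^d$ satisfying the inclusion almost everywhere and the initial condition. The parameterized semi-implicit Euler scheme is $\Phi(t,x;h)=\{z\in\mathbb{R}^d: z\in x+hf(t+h,z)+hM(t,x)\}$; its trajectories are the sequences with $y_0=x_0$, $y_{n+1}\in\Phi(t_n,y_n;h_n)$. $C>0$ is a constant such that all solutions of the differential inclusion and all trajectories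 of $\Phi$ (with initial value $x_0$) are contained in $B_C(0)$ (such a $C$ exists). Set, for $\delta\ge0$, $\tau_f(\delta)=\sup\{|f(t,x)-f(t',x)|:t,t'\in[0,T],|t-t'|\le\delta,x\in B_C(0)\}$, $\chi_f(\delta)=\sup\{|f(t,x)-f(t,x')|:t\in[0,T],x,x'\in B_C(0),|x-x'|\le\delta\}$, $\tau_M(\delta)=\sup\{\operatorname{dist}(M(t,x),M(t',x)):t,t'\in[0,T],|t-t'|\le\delta,x\in B_C(0)\}$, $P=\max_{[0,T]\times B_C(0)}|f|+\max_{[0,T]\times B_C(0)}\|M\|$, and $\Gamma(h,t)=\tau_f(h)+\chi_f(Ph)+\tau_M(h)+L_M(t)Ph$. *)

theory Defs
  imports "HOL-Analysis.Analysis"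
begin

text \<open>All the following real-valued infima and suprema are only meaningful for nonempty (bounded)
  sets; they are used for nonempty compact sets, where \<open>infdist a B\<close> is \<open>INF b\<in>B. dist a b\<close>.\<close>

definition set_excess :: "'a::euclidean_space set \<Rightarrow> 'a set \<Rightarrow> real" where
  "set_excess A B = (SUP a\<in>A. infdist a B)"

definition hausdorff_dist :: "'a::euclidean_space set \<Rightarrow> 'a set \<Rightarrow> real" where
  "hausdorff_dist A B = max (set_excess A B) (set_excess B A)"

definition set_norm :: "'a::euclidean_space set \<Rightarrow> real" where
  "set_norm A = (SUP a\<in>A. norm a)"

definition hausdorff_continuous_on ::
    "'b::topological_space set \<Rightarrow> ('b \<Rightarrow> 'a::euclidean_space set) \<Rightarrow> bool" where
  "hausdorff_continuous_on S F \<longleftrightarrow>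
     (\<forall>p\<in>S. ((\<lambda>q. hausdorff_dist (F q) (F p)) \<longlongrightarrow> 0) (at p within S))"

text \<open>A pair \<open>(u, v) \<in> I\<close> stands for the interval with end points \<open>u \<le> v\<close>.\<close>

definition absolutely_continuous_on_interval ::
    "real \<Rightarrow> real \<Rightarrow> (real \<Rightarrow> 'a::euclidean_space) \<Rightarrow> bool" where
  "absolutely_continuous_on_interval a b x \<longleftrightarrow>
     (\<forall>\<epsilon>>0. \<exists>\<delta>>0. \<forall>I.
        finite I \<and> (\<forall>(u, v)\<in>I. a \<le> u \<and> u \<le> v \<and> v \<le> b) \<and>
        disjoint_family_on (\<lambda>(u, v). {u<..<v}) I \<and> (\<Sum>(u, v)\<in>I. v - u) < \<delta>
        \<longrightarrow> (\<Sum>(u, v)\<in>I. norm (x v - x u)) < \<epsilon>)"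

definition di_solution ::
    "(real \<Rightarrow> 'a::euclidean_space \<Rightarrow> 'a set) \<Rightarrow> real \<Rightarrow> 'a \<Rightarrow> (real \<Rightarrow> 'a) \<Rightarrow> bool" where
  "di_solution F T x0 x \<longleftrightarrow>
     absolutely_continuous_on_interval 0 T x \<and> x 0 = x0 \<and>
     (AE t in lebesgue_on {0..T}.
        \<exists>v. (x has_vector_derivative v) (at t within {0..T}) \<and> v \<in> F t (x t))"

definition rhs ::
    "(real \<Rightarrow> 'a::euclidean_space \<Rightarrow> 'a) \<Rightarrow> (real \<Rightarrow> 'a \<Rightarrow> 'a set) \<Rightarrow> real \<Rightarrow> 'a \<Rightarrow> 'a set" where
  "rhs f M t x = (\<lambda>m. f t x + m) ` M t x"

definition euler_step ::
    "(real \<Rightarrow> 'a::euclidean_space \<Rightarrow> 'a) \<Rightarrow> (real \<Rightarrow> 'a \<Rightarrow> 'a set) \<Rightarrow> real \<Rightarrow> 'a \<Rightarrow> real \<Rightarrow> 'a set" where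
  "euler_step f M t x h =
     {z. z \<in> (\<lambda>m. x + h *\<^sub>R f (t + h) z + h *\<^sub>R m) ` M t x}"

text \<open>A grid of \<open>N\<close> steps is a function on \<^typ>\<open>nat\<close>, of which only the values at \<open>0, \<dots>, N\<close>
  matter; the same applies to trajectories on it.\<close>

definition is_grid :: "real \<Rightarrow> nat \<Rightarrow> (nat \<Rightarrow> real) \<Rightarrow> bool" where
  "is_grid T N tt \<longleftrightarrow> tt 0 = 0 \<and> (\<forall>n<N. tt n < tt (Suc n)) \<and> tt N = T"

definition step_size :: "(nat \<Rightarrow> real) \<Rightarrow> nat \<Rightarrow> real" where
  "step_size tt n = tt (Suc n) - tt n"

definition max_step :: "nat \<Rightarrow> (nat \<Rightarrow> real) \<Rightarrow> real" where
  "max_step N tt = Max (step_size tt ` {..<N})"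

definition euler_trajectory ::
    "(real \<Rightarrow> 'a::euclidean_space \<Rightarrow> 'a) \<Rightarrow> (real \<Rightarrow> 'a \<Rightarrow> 'a set) \<Rightarrow> nat \<Rightarrow> (nat \<Rightarrow> real) \<Rightarrow> 'a
      \<Rightarrow> (nat \<Rightarrow> 'a) \<Rightarrow> bool" where
  "euler_trajectory f M N tt x0 y \<longleftrightarrow>
     y 0 = x0 \<and> (\<forall>n<N. y (Suc n) \<in> euler_step f M (tt n) (y n) (step_size tt n))"

definition tau_f :: "(real \<Rightarrow> 'a::euclidean_space \<Rightarrow> 'a) \<Rightarrow> real \<Rightarrow> real \<Rightarrow> real \<Rightarrow> real" where
  "tau_f f T C \<delta> =
     Sup {norm (f t x - f t' x) | t t' x.
            t \<in> {0..T} \<and> t' \<in> {0..T} \<and> \<bar>t - t'\<bar> \<le> \<delta> \<and> x \<in> cball 0 C}"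

definition chi_f :: "(real \<Rightarrow> 'a::euclidean_space \<Rightarrow> 'a) \<Rightarrow> real \<Rightarrow> real \<Rightarrow> real \<Rightarrow> real" where
  "chi_f f T C \<delta> =
     Sup {norm (f t x - f t x') | t x x'.
            t \<in> {0..T} \<and> x \<in> cball 0 C \<and> x' \<in> cball 0 C \<and> norm (x - x') \<le> \<delta>}"

definition tau_M :: "(real \<Rightarrow> 'a::euclidean_space \<Rightarrow> 'a set) \<Rightarrow> real \<Rightarrow> real \<Rightarrow> real \<Rightarrow> real" where
  "tau_M M T C \<delta> =
     Sup {set_excess (M t x) (M t' x) | t t' x.
            t \<in> {0..T} \<and> t' \<in> {0..T} \<and> \<bar>t - t'\<bar> \<le> \<delta> \<and> x \<in> cball 0 C}"

text \<open>For \<open>f\<close> continuous and \<open>M\<close> Hausdorff continuous, both suprema are maxima.\<close>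

definition P_const ::
    "(real \<Rightarrow> 'a::euclidean_space \<Rightarrow> 'a) \<Rightarrow> (real \<Rightarrow> 'a \<Rightarrow> 'a set) \<Rightarrow> real \<Rightarrow> real \<Rightarrow> real" where
  "P_const f M T C =
     (SUP (t, x)\<in>{0..T} \<times> cball 0 C. norm (f t x)) +
     (SUP (t, x)\<in>{0..T} \<times> cball 0 C. set_norm (M t x))"

definition Gamma_err ::
    "(real \<Rightarrow> 'a::euclidean_space \<Rightarrow> 'a) \<Rightarrow> (real \<Rightarrow> 'a \<Rightarrow> 'a set) \<Rightarrow> (real \<Rightarrow> real) \<Rightarrow> real \<Rightarrow> real
      \<Rightarrow> real \<Rightarrow> real \<Rightarrow> real" where
  "Gamma_err f M L_M T C h t =
     tau_f f T C h + chi_f f T C (P_const f M T C * h) + tau_M M T C h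
       + L_M t * P_const f M T C * h"

end

theory Submission
  imports Defs "HOL-Complex_Analysis.Great_Picard"
begin

text \<open>Let \<open>y\<close> be the piecewise linear interpolation of the trajectory, with slope
  \<open>f (tt (Suc k)) (Y (Suc k)) + m k\<close> on the \<open>k\<close>-th step, where \<open>m k \<in> M (tt k) (Y k)\<close>. Since \<open>M\<close> is
  continuous with convex values, projecting \<open>m k\<close> onto \<open>M t x\<close> is a selection of \<open>M\<close> that is continuous
  on each step, so it suffices to solve the ordinary differential equation with right-hand side
  \<open>f t x + closest_point (M t x) (m k)\<close>. By the one-sided Lipschitz condition on \<open>f\<close> and the Lipschitz
  condition on \<open>M\<close>, the difference \<open>w = x - y\<close> satisfies
  \<open>w \<bullet> w' \<le> (l_f + L_M) * (norm w)\<^sup>2 + Gamma * norm w\<close>. This estimate first yields an a priori bound, hence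
  global existence, and then by Gronwall's inequality the claim.\<close>

subsection \<open>Existence of Caratheodory solutions\<close>

lemma norm_integral_increment_le:
  fixes f :: "real \<Rightarrow> 'a::banach"
  assumes "f integrable_on {a..b}" "\<And>r. r \<in> {a..b} \<Longrightarrow> norm (f r) \<le> B"
    and st: "a \<le> s" "s \<le> t" "t \<le> b"
  shows "norm (integral {a..t} f - integral {a..s} f) \<le> B * (t - s)"
proof -
  have f: "f integrable_on {a..t}" "f integrable_on {s..t}"
    by (rule integrable_on_subinterval[OF assms(1)]; use st in simp)+
  have "integral {a..s} f + integral {s..t} f = integral {a..t} f"
    by (rule Henstock_Kurzweil_Integration.integral_combine[OF st(1,2) f(1)])
  then have "norm (integral {a..t} f - integral {a..s} f) = norm (integral {s..t} f)"
    by (metis add_diff_cancel_left')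
  also have "norm (integral {s..t} f) \<le> integral {s..t} (\<lambda>_. B)"
    using st assms(2) by (intro integral_norm_bound_integral f(2) integrable_const_ivl) auto
  also have "\<dots> = B * (t - s)" using st(2) by simp
  finally show ?thesis .
qed

text \<open>Tonelli's construction: the equations with delay \<open>d n\<close> are solved exactly by iteration, and
  Arzela-Ascoli gives a limit as the delay vanishes.\<close>

lemma caratheodory_existence:
  fixes g :: "real \<Rightarrow> 'a::euclidean_space \<Rightarrow> 'a"
  assumes "a \<le> b"
    and int: "\<And>X. continuous_on {a..b} X \<Longrightarrow> (\<lambda>s. g s (X s)) integrable_on {a..b}"
    and cont: "\<And>s. s \<in> {a..b} \<Longrightarrow> continuous_on UNIV (g s)"
    and bound: "\<And>s x. s \<in> {a..b} \<Longrightarrow> norm (g s x) \<le> B"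
  obtains x where "continuous_on {a..b} x"
    and "\<And>t. t \<in> {a..b} \<Longrightarrow> x t = x0 + integral {a..t} (\<lambda>s. g s (x s))"
proof -
  have B0: "0 \<le> B" using order_trans[OF norm_ge_zero bound[of a 0]] \<open>a \<le> b\<close> by simp
  \<comment> \<open>Clamping the delayed argument at \<open>a\<close> extends a path to the left by
    its initial value, so the delayed equation needs no separate history.\<close>
  have delay_cont: "continuous_on {a..b} (\<lambda>s. X (max a (s - d)))"
    if "continuous_on {a..b} X" "d > 0" for X :: "real \<Rightarrow> 'a" and d
    by (intro continuous_on_compose2[OF that(1)] continuous_intros) (use \<open>d > 0\<close> \<open>a \<le> b\<close> in auto)
  have ex_delay: "\<exists>X. continuous_on {a..b} X \<and>
      (\<forall>t\<in>{a..b}. X t = x0 + integral {a..t} (\<lambda>s. g s (X (max a (s - d)))))"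
    if "d > 0" for d
  proof -
    define F where "F X t = x0 + integral {a..t} (\<lambda>s. g s (X (max a (s - d))))" for X t
    define Z where "Z j = (F ^^ j) (\<lambda>_. x0)" for j
    have Z_Suc: "Z (Suc j) = F (Z j)" for j by (simp add: Z_def)
    have Z_cont: "continuous_on {a..b} (Z j)" for j
    proof (induction j)
      case 0
      then show ?case by (simp add: Z_def)
    next
      case (Suc j)
      then show ?case unfolding Z_Suc F_def
        by (intro continuous_intros indefinite_integral_continuous_1 int delay_cont \<open>d > 0\<close>)
    qed
    \<comment> \<open>Because of the delay, each iteration fixes the values on one more interval of length \<open>d\<close>.\<close>
    have agree: "\<forall>t\<in>{a..b}. t \<le> a + real j * d \<longrightarrow> Z (Suc j) t = Z j t" for j
    proof (induction j)
      case 0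
      then show ?case by (auto simp: Z_def F_def)
    next
      case (Suc j)
      show ?case
      proof (intro ballI impI)
        fix t assume t: "t \<in> {a..b}" "t \<le> a + real (Suc j) * d"
        have "Z (Suc j) (max a (s - d)) = Z j (max a (s - d))" if "s \<in> {a..t}" for s
          using Suc that t \<open>d > 0\<close> by (auto simp: algebra_simps)
        then show "Z (Suc (Suc j)) t = Z (Suc j) t"
          unfolding Z_Suc[of "Suc j"] Z_Suc[of j] F_def
          by (intro arg_cong2[where f = "(+)"] integral_cong) (auto simp: Z_Suc F_def)
      qed
    qed
    \<comment> \<open>\<open>J\<close> delays cover \<open>{a..b}\<close>, so by
      \<open>agree\<close> the iterate \<open>Z J\<close> is already an exact fixed point of
      \<open>F\<close> and no limit of iterates is required.\<close>
    obtain J :: nat where J: "(b - a) / d \<le> real J" using real_arch_simple by blast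
    then have J': "b \<le> a + real J * d" using \<open>d > 0\<close> by (simp add: field_simps)
    have "Z J t = F (Z J) t" if "t \<in> {a..b}" for t
      using agree[of J] that J' by (auto simp: Z_Suc)
    with Z_cont[of J] show ?thesis unfolding F_def by blast
  qed
  define d where "d n = 1 / (real n + 1)" for n
  have d_pos: "d n > 0" for n by (simp add: d_def)
  obtain X where X_cont: "\<And>n. continuous_on {a..b} (X n)"
    and X_eq: "\<And>n t. t \<in> {a..b} \<Longrightarrow>
      X n t = x0 + integral {a..t} (\<lambda>s. g s (X n (max a (s - d n))))"
    using ex_delay[OF d_pos] by metis
  have X_int: "(\<lambda>s. g s (X n (max a (s - d n)))) integrable_on {a..b}" for n
    by (intro int delay_cont X_cont d_pos)
  \<comment> \<open>The Lipschitz constant \<open>B\<close> does not depend on the delay, which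
    gives the equicontinuity for Arzela-Ascoli and, later, the vanishing of the effect of the
    delay.\<close>
  have X_lip_le: "norm (X n t - X n s) \<le> B * (t - s)" if "s \<in> {a..b}" "t \<in> {a..b}" "s \<le> t" for n s t
    using norm_integral_increment_le[OF X_int[of n] bound, of s t] that by (simp add: X_eq)
  have X_lip: "norm (X n t - X n s) \<le> B * \<bar>t - s\<bar>" if "s \<in> {a..b}" "t \<in> {a..b}" for n s t
    using X_lip_le[of s t n] X_lip_le[of t s n] that by (cases "s \<le> t") (auto simp: norm_minus_commute)
  obtain x k where x_cont: "continuous_on {a..b} x" and k: "strict_mono (k :: nat \<Rightarrow> nat)"
    and unif: "\<And>e. 0 < e \<Longrightarrow> \<exists>N. \<forall>n t. n \<ge> N \<and> t \<in> {a..b} \<longrightarrow> norm (X (k n) t - x t) < e"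
  proof (rule Arzela_Ascoli[of "{a..b}" X "norm x0 + B * (b - a)"])
    show "norm (X n t) \<le> norm x0 + B * (b - a)" if "t \<in> {a..b}" for n t
    proof -
      have "X n a = x0" using X_eq[of a n] \<open>a \<le> b\<close> by simp
      then have "norm (X n t - x0) \<le> B * (t - a)" using X_lip_le[of a t n] that by auto
      also have "\<dots> \<le> B * (b - a)" using B0 that by (intro mult_left_mono) auto
      finally show ?thesis using norm_triangle_sub[of "X n t" x0] by linarith
    qed
    show "\<exists>d>0. \<forall>n u. u \<in> {a..b} \<and> norm (t - u) < d \<longrightarrow> norm (X n t - X n u) < e"
      if "t \<in> {a..b}" "0 < e" for t e
    \<comment> \<open>\<open>B\<close> may be 0, hence the divisor \<open>B + 1\<close>.\<close>
    proof (intro exI[of _ "e / (B + 1)"] conjI allI impI)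
      show "0 < e / (B + 1)" using B0 \<open>0 < e\<close> by simp
      fix n u assume u: "u \<in> {a..b} \<and> norm (t - u) < e / (B + 1)"
      have "norm (X n t - X n u) \<le> B * \<bar>t - u\<bar>" using X_lip u that by blast
      also have "\<dots> \<le> (B + 1) * \<bar>t - u\<bar>" using B0 by (intro mult_right_mono) auto
      also have "\<dots> < e" using u B0 by (simp add: field_simps)
      finally show "norm (X n t - X n u) < e" .
    qed
  qed auto
  have X_lim: "(\<lambda>n. X (k n) t) \<longlonglongrightarrow> x t" if "t \<in> {a..b}" for t
    by (rule LIMSEQ_I) (use unif that in blast)
  have d_lim: "(\<lambda>n. d (k n)) \<longlonglongrightarrow> 0"
    using LIMSEQ_subseq_LIMSEQ[OF LIMSEQ_inverse_real_of_nat k]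
    by (simp add: d_def o_def inverse_eq_divide add.commute)
  have X_delay_lim: "(\<lambda>n. X (k n) (max a (t - d (k n)))) \<longlonglongrightarrow> x t" if t: "t \<in> {a..b}" for t
  proof -
    have "norm (X (k n) (max a (t - d (k n))) - X (k n) t) \<le> B * d (k n)" for n
    proof -
      have "norm (X (k n) (max a (t - d (k n))) - X (k n) t) \<le> B * \<bar>max a (t - d (k n)) - t\<bar>"
        by (rule X_lip) (use t d_pos[of "k n"] in auto)
      also have "\<dots> \<le> B * d (k n)"
        using B0 t d_pos[of "k n"] by (intro mult_left_mono) auto
      finally show ?thesis .
    qed
    moreover have "(\<lambda>n. B * d (k n)) \<longlonglongrightarrow> 0" using tendsto_mult_right_zero[OF d_lim] .
    ultimately have "(\<lambda>n. X (k n) (max a (t - d (k n))) - X (k n) t) \<longlonglongrightarrow> 0"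
      by (rule Lim_null_comparison[OF always_eventually, rule_format])
    from tendsto_add[OF this X_lim[OF t]] show ?thesis by simp
  qed
  have "x t = x0 + integral {a..t} (\<lambda>s. g s (x s))" if t: "t \<in> {a..b}" for t
  proof -
    have "(\<lambda>n. integral {a..t} (\<lambda>s. g s (X (k n) (max a (s - d (k n))))))
        \<longlonglongrightarrow> integral {a..t} (\<lambda>s. g s (x s))"
    \<comment> \<open>Continuity of each single \<open>g s\<close> yields only pointwise convergence
      of the integrands; the uniform bound \<open>B\<close> serves as the dominating
      function.\<close>
    proof (rule dominated_convergence(2)[where h = "\<lambda>_. B"])
      show "(\<lambda>s. g s (X (k n) (max a (s - d (k n))))) integrable_on {a..t}" for n
        by (rule integrable_on_subinterval[OF X_int]) (use t in auto)
      show "(\<lambda>n. g s (X (k n) (max a (s - d (k n))))) \<longlonglongrightarrow> g s (x s)" if "s \<in> {a..t}" for s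
        using continuous_on_tendsto_compose[OF cont X_delay_lim] that t by auto
    qed (use bound t in auto)
    moreover have "(\<lambda>n. integral {a..t} (\<lambda>s. g s (X (k n) (max a (s - d (k n))))))
        \<longlonglongrightarrow> x t - x0"
      using tendsto_diff[OF X_lim[OF t] tendsto_const[of x0]] X_eq[OF t] by (simp add: algebra_simps)
    ultimately show ?thesis using LIMSEQ_unique by fastforce
  qed
  with x_cont show thesis by (rule that)
qed

subsection \<open>Dissipative equations\<close>

text \<open>The integrating factor \<open>exp (integral {t..b} L)\<close> makes the derivative of
  its product with \<open>norm (w t)\<close> at most the factor times \<open>G t\<close>, and it
  equals 1 at \<open>b\<close>. A bound on the inner product instead of on
  \<open>norm (w' t)\<close> fits one-sided Lipschitz conditions and admits negative
  \<open>L\<close>; the finite set \<open>S\<close> admits kinks of \<open>w\<close>.\<close>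

lemma gronwall_norm:
  fixes w w' :: "real \<Rightarrow> 'a::real_inner"
  assumes "a \<le> b" "finite S"
    and w: "continuous_on {a..b} w"
    and w': "\<And>t. t \<in> {a<..<b} - S \<Longrightarrow> (w has_vector_derivative w' t) (at t)"
    and L: "continuous_on {a..b} L" and G: "continuous_on {a..b} G"
    and G0: "\<And>t. t \<in> {a..b} \<Longrightarrow> 0 \<le> G t"
    and dissip: "\<And>t. t \<in> {a<..<b} - S \<Longrightarrow> w t \<bullet> w' t \<le> L t * (norm (w t))\<^sup>2 + G t * norm (w t)"
  shows "norm (w b) \<le> exp (integral {a..b} L) * norm (w a)
           + integral {a..b} (\<lambda>t. exp (integral {t..b} L) * G t)"
proof -
  define E where "E t = exp (integral {t..b} L)" for t
  have L_int: "L integrable_on {a..b}" using L by (rule integrable_continuous_real)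
  \<comment> \<open>Moves the variable to the upper limit of integration, where the fundamental
    theorem of calculus applies.\<close>
  have E_eq: "E t = exp (integral {a..b} L - integral {a..t} L)" if "t \<in> {a..b}" for t
    using Henstock_Kurzweil_Integration.integral_combine[of a t b L] that L_int by (auto simp: E_def)
  have E_cont: "continuous_on {a..b} E"
    by (rule continuous_on_eq[of _ "\<lambda>t. exp (integral {a..b} L - integral {a..t} L)"])
      (auto intro!: continuous_intros indefinite_integral_continuous_1 L_int simp: E_eq)
  have E_deriv: "(E has_real_derivative - L t * E t) (at t)" if t: "t \<in> {a<..<b}" for t
  proof -
    have at: "at t within {a..b} = at t" using t by (simp add: at_within_Icc_at)
    have "((\<lambda>t. integral {a..t} L) has_real_derivative L t) (at t)"
      using integral_has_real_derivative[OF L, of t] t by (simp add: at)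
    from DERIV_fun_exp[OF DERIV_diff[OF DERIV_const this], of "integral {a..b} L"]
    have "((\<lambda>t. exp (integral {a..b} L - integral {a..t} L)) has_real_derivative - L t * E t) (at t)"
      using t by (simp add: E_eq mult.commute)
    then show ?thesis
      by (rule has_field_derivative_transform_within_open[where S = "{a<..<b}"])
        (use t E_eq in auto)
  qed
  obtain B where B: "\<And>t. t \<in> {a..b} \<Longrightarrow> \<bar>L t\<bar> \<le> B"
    using compact_imp_bounded[OF compact_continuous_image[OF L compact_Icc]]
    by (fastforce simp: bounded_iff)
  have B0: "0 \<le> B" using B[of a] \<open>a \<le> b\<close> by auto
  let ?I = "integral {a..b} (\<lambda>t. E t * G t)"
  let ?c = "E a + B * integral {a..b} E"
  have E_int: "E integrable_on {a..b}" "(\<lambda>t. E t * G t) integrable_on {a..b}"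
    using E_cont G by (auto intro!: integrable_continuous_real continuous_intros)
  have eps: "norm (w b) \<le> E a * norm (w a) + ?I + e * ?c" if e: "0 < e" for e
  proof -
    \<comment> \<open>a smooth substitute for \<open>norm (w t)\<close>, which need not be differentiable where \<open>w\<close> vanishes\<close>
    define u where "u t = sqrt ((norm (w t))\<^sup>2 + e\<^sup>2)" for t
    have u_pos: "0 < u t" for t using e by (auto simp: u_def intro!: add_nonneg_pos)
    have u_sq: "(u t)\<^sup>2 = (norm (w t))\<^sup>2 + e\<^sup>2" for t by (simp add: u_def)
    have u_ge: "norm (w t) \<le> u t" "e \<le> u t" for t
      unfolding u_def using e by (auto intro!: real_le_rsqrt)
    \<comment> \<open>At the exceptional points and the end points the value of the derivative is
      immaterial; it is set to the desired upper bound, so that the bound holds on all of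
      \<open>{a..b}\<close>.\<close>
    define p where "p t = (if t \<in> S \<union> {a, b} then E t * (G t + B * e)
      else - L t * E t * u t + E t * ((w t \<bullet> w' t) / u t))" for t
    have "(p has_integral E b * u b - E a * u a) {a..b}"
    proof (rule fundamental_theorem_of_calculus_interior_strong[OF \<open>finite S\<close> \<open>a \<le> b\<close>])
      show "continuous_on {a..b} (\<lambda>t. E t * u t)"
        unfolding u_def by (intro continuous_intros E_cont w)
      fix t assume t: "t \<in> {a<..<b} - S"
      have "((\<lambda>t. w t \<bullet> w t) has_vector_derivative w t \<bullet> w' t + w' t \<bullet> w t) (at t)"
        by (rule bounded_bilinear.has_vector_derivative[OF bounded_bilinear_inner w'[OF t] w'[OF t]])
      then have "((\<lambda>t. w t \<bullet> w t) has_real_derivative 2 * (w t \<bullet> w' t)) (at t)"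
        by (simp add: has_real_derivative_iff_has_vector_derivative inner_commute)
      then have sq: "((\<lambda>t. (norm (w t))\<^sup>2 + e\<^sup>2) has_real_derivative 2 * (w t \<bullet> w' t)) (at t)"
        by (auto simp: power2_norm_eq_inner intro!: derivative_eq_intros)
      have halve: "inverse c / 2 * (2 * q) = q / c" for c q :: real by (simp add: field_simps)
      have pos: "0 < (norm (w t))\<^sup>2 + e\<^sup>2" using e by (intro add_nonneg_pos) auto
      have "((\<lambda>t. sqrt ((norm (w t))\<^sup>2 + e\<^sup>2)) has_real_derivative (w t \<bullet> w' t) / u t) (at t)"
        by (rule DERIV_cong[OF DERIV_chain2[OF DERIV_real_sqrt[OF pos] sq]]) (simp only: u_def halve)
      then have "(u has_real_derivative (w t \<bullet> w' t) / u t) (at t)"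
        by (simp only: u_def[abs_def])
      from DERIV_mult[OF E_deriv this] t
      have "((\<lambda>t. E t * u t) has_real_derivative - L t * E t * u t + (w t \<bullet> w' t) / u t * E t) (at t)"
        by blast
      then have "((\<lambda>t. E t * u t) has_real_derivative p t) (at t)"
        by (rule DERIV_cong) (use t in \<open>simp add: p_def mult.commute\<close>)
      then show "((\<lambda>t. E t * u t) has_vector_derivative p t) (at t)"
        by (simp add: has_real_derivative_iff_has_vector_derivative)
    qed
    moreover have "((\<lambda>t. E t * G t + (B * e) * E t) has_integral (?I + (B * e) * integral {a..b} E)) {a..b}"
      by (intro has_integral_add has_integral_mult_right integrable_integral E_int)
    moreover have "p t \<le> E t * G t + (B * e) * E t" if t: "t \<in> {a..b}" for t
    proof (cases "t \<in> S \<union> {a, b}")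
      case True
      then show ?thesis by (simp add: p_def algebra_simps)
    next
      case False
      have "(w t \<bullet> w' t) \<le> L t * (norm (w t))\<^sup>2 + G t * norm (w t)"
        using dissip[of t] False t by auto
      also have "\<dots> \<le> L t * ((u t)\<^sup>2 - e\<^sup>2) + G t * u t"
        using mult_left_mono[OF u_ge(1)[of t] G0[OF t]] by (simp add: u_sq)
      \<comment> \<open>Where \<open>L t\<close> is negative, the smoothing leaves the positive term
        \<open>- L t * e\<^sup>2\<close>. Since \<open>e \<le> u t\<close>, it is at most
        \<open>B * e * u t\<close>, which after division by \<open>u t\<close> becomes an error of
        order \<open>e\<close>.\<close>
      also have "\<dots> \<le> L t * (u t)\<^sup>2 + B * e * u t + G t * u t"
      proof -
        have "- L t * e\<^sup>2 \<le> B * e\<^sup>2" using B[OF t] by (intro mult_right_mono) auto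
        also have "\<dots> \<le> B * (e * u t)"
          using u_ge[of t] e B0 by (auto simp: power2_eq_square intro!: mult_left_mono)
        finally show ?thesis by (simp add: algebra_simps)
      qed
      finally have "(w t \<bullet> w' t) / u t \<le> L t * u t + B * e + G t"
        using u_pos[of t] by (simp add: field_simps power2_eq_square)
      then have "E t * ((w t \<bullet> w' t) / u t) \<le> E t * (L t * u t + B * e + G t)"
        by (intro mult_left_mono) (auto simp: E_def)
      then show ?thesis using False by (simp add: p_def algebra_simps)
    qed
    ultimately have "E b * u b - E a * u a \<le> ?I + (B * e) * integral {a..b} E"
      by (rule has_integral_le)
    moreover have "E b = 1" by (simp add: E_def)
    moreover have "E a * u a \<le> E a * (norm (w a) + e)"
      unfolding u_def using sqrt_sum_squares_le_sum[of "norm (w a)" e] e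
      by (intro mult_left_mono) (auto simp: E_def)
    ultimately show ?thesis using u_ge(1)[of b] by (simp add: algebra_simps)
  qed
  have "((\<lambda>e. E a * norm (w a) + ?I + e * ?c) \<longlongrightarrow> E a * norm (w a) + ?I + 0 * ?c) (at_right 0)"
    by (intro tendsto_intros)
  moreover have "\<forall>\<^sub>F e in at_right 0. norm (w b) \<le> E a * norm (w a) + ?I + e * ?c"
    using eps by (auto simp: eventually_at_right_field intro!: exI[of _ 1])
  ultimately have "norm (w b) \<le> E a * norm (w a) + ?I + 0 * ?c"
    by (intro tendsto_lowerbound[of _ _ "at_right 0"]) auto
  then show ?thesis by (simp add: E_def)
qed

text \<open>Finds an exact solution near an approximate one, \<open>y\<close>, whose defect is
  measured by \<open>G\<close>. Dissipativity relative to \<open>y\<close> excludes blow-up although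
  \<open>g\<close> may grow arbitrarily in \<open>x\<close>. Integrability along paths is separate
  from continuity off \<open>S\<close>, because \<open>g\<close> may jump in time at the points of
  \<open>S\<close>.\<close>

lemma dissipative_solution:
  fixes g :: "real \<Rightarrow> 'a::euclidean_space \<Rightarrow> 'a" and y y' :: "real \<Rightarrow> 'a"
  assumes "a \<le> b" "finite S"
    and y: "continuous_on {a..b} y"
    and y': "\<And>t. t \<in> {a<..<b} - S \<Longrightarrow> (y has_vector_derivative y' t) (at t)"
    and cont: "\<And>t. t \<in> {a..b} \<Longrightarrow> continuous_on UNIV (g t)"
    and path_int: "\<And>X. continuous_on {a..b} X \<Longrightarrow> (\<lambda>s. g s (X s)) integrable_on {a..b}"
    and path_cont: "\<And>X t. continuous_on {a..b} X \<Longrightarrow> t \<in> {a<..<b} - S \<Longrightarrow> isCont (\<lambda>s. g s (X s)) t"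
    and bounded: "\<And>R. \<exists>B. \<forall>t\<in>{a..b}. \<forall>x\<in>cball 0 R. norm (g t x) \<le> B"
    and L: "continuous_on {a..b} L" and G: "continuous_on {a..b} G"
    and G0: "\<And>t. t \<in> {a..b} \<Longrightarrow> 0 \<le> G t"
    and dissip: "\<And>t x. t \<in> {a..b} \<Longrightarrow>
      (x - y t) \<bullet> (g t x - y' t) \<le> L t * (norm (x - y t))\<^sup>2 + G t * norm (x - y t)"
  obtains x B where "x a = y a"
    and "\<And>s t. a \<le> s \<Longrightarrow> s \<le> t \<Longrightarrow> t \<le> b \<Longrightarrow> norm (x t - x s) \<le> B * (t - s)"
    and "\<And>t. t \<in> {a<..<b} - S \<Longrightarrow> (x has_vector_derivative g t (x t)) (at t)"
    and "\<And>t. t \<in> {a..b} \<Longrightarrow>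
      norm (x t - y t) \<le> integral {a..t} (\<lambda>s. exp (integral {s..t} L) * G s)"
proof -
  obtain K where K: "\<And>t. t \<in> {a..b} \<Longrightarrow> \<bar>L t\<bar> \<le> K"
    using compact_imp_bounded[OF compact_continuous_image[OF L compact_Icc]]
    by (fastforce simp: bounded_iff)
  obtain H where H: "\<And>t. t \<in> {a..b} \<Longrightarrow> \<bar>G t\<bar> \<le> H"
    using compact_imp_bounded[OF compact_continuous_image[OF G compact_Icc]]
    by (fastforce simp: bounded_iff)
  obtain Y where Y: "\<And>t. t \<in> {a..b} \<Longrightarrow> norm (y t) \<le> Y"
    using compact_imp_bounded[OF compact_continuous_image[OF y compact_Icc]]
    by (fastforce simp: bounded_iff)
  have K0: "0 \<le> K" and H0: "0 \<le> H" using K[of a] H[of a] \<open>a \<le> b\<close> by auto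
  \<comment> \<open>The second argument bounds what Gronwall gives for the constants
    \<open>K\<close> and \<open>H\<close> and the initial value 0; the maximum with 1 keeps the
    divisor \<open>R\<close> positive.\<close>
  define R where "R = max 1 (exp (K * (b - a)) * H * (b - a))"
  have R: "0 < R" "exp (K * (b - a)) * H * (b - a) \<le> R" by (auto simp: R_def)
  \<comment> \<open>Radial truncation of \<open>x - y t\<close> makes the right-hand side bounded but, scaling \<open>x - y t\<close> only
    by positive factors, preserves the dissipativity estimate with the constants \<open>K\<close>, \<open>H\<close>. Hence
    the truncated solution stays where the truncation is inactive.\<close>
  define cut where "cut w = (R / max R (norm w)) *\<^sub>R w" for w :: 'a
  have cut_cont: "continuous_on A cut" for A
    unfolding cut_def using R by (intro continuous_intros) auto
  have cut_small: "cut w = w" if "norm w \<le> R" for w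
    using that R by (simp add: cut_def max_absorb1)
  have norm_cut: "norm (cut w) = R / max R (norm w) * norm w" for w
    using R by (simp add: cut_def)
  have cut_le: "norm (cut w) \<le> R" "norm (cut w) \<le> norm w" for w
    using R by (auto simp: norm_cut field_simps max_def)
  have cut_scale: "w = (max R (norm w) / R) *\<^sub>R cut w" "max R (norm w) / R * norm (cut w) = norm w" for w
    using R by (auto simp: norm_cut cut_def)
  define gt where "gt t x = g t (y t + cut (x - y t))" for t x
  have path: "continuous_on {a..b} (\<lambda>s. y s + cut (X s - y s))" if "continuous_on {a..b} X" for X
    by (intro continuous_intros y continuous_on_compose2[OF cut_cont[of UNIV]] that) auto
  obtain B where B: "\<And>t x. t \<in> {a..b} \<Longrightarrow> x \<in> cball 0 (Y + R) \<Longrightarrow> norm (g t x) \<le> B"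
    using bounded[of "Y + R"] by blast
  have gt_bound: "norm (gt t x) \<le> B" if "t \<in> {a..b}" for t x
    unfolding gt_def
    using norm_triangle_le[of "y t" "cut (x - y t)" "Y + R"] Y[OF that] cut_le(1)[of "x - y t"]
    by (intro B that) auto
  obtain x where x_cont: "continuous_on {a..b} x"
    and x_eq: "\<And>t. t \<in> {a..b} \<Longrightarrow> x t = y a + integral {a..t} (\<lambda>s. gt s (x s))"
  proof (rule caratheodory_existence[of a b gt B "y a"])
    show "(\<lambda>s. gt s (X s)) integrable_on {a..b}" if "continuous_on {a..b} X" for X
      unfolding gt_def by (rule path_int[OF path[OF that]])
    show "continuous_on UNIV (gt s)" if "s \<in> {a..b}" for s
      unfolding gt_def
      by (intro continuous_on_compose2[OF cont[OF that]] continuous_on_compose2[OF cut_cont[of UNIV]]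
          continuous_intros) auto
  qed (use \<open>a \<le> b\<close> gt_bound in auto)
  have gt_int: "(\<lambda>s. gt s (x s)) integrable_on {a..b}"
    unfolding gt_def by (rule path_int[OF path[OF x_cont]])
  have x_deriv: "(x has_vector_derivative gt t (x t)) (at t)" if t: "t \<in> {a<..<b} - S" for t
  proof -
    have "isCont (\<lambda>s. gt s (x s)) t"
      unfolding gt_def by (rule path_cont[OF path[OF x_cont] t])
    then have "((\<lambda>u. integral {a..u} (\<lambda>s. gt s (x s))) has_vector_derivative gt t (x t)) (at t within {a..b} - {})"
      using t by (intro integral_has_vector_derivative_continuous_at gt_int)
        (auto intro: continuous_at_imp_continuous_at_within)
    then have "((\<lambda>u. integral {a..u} (\<lambda>s. gt s (x s))) has_vector_derivative gt t (x t)) (at t)"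
      using t by (simp add: at_within_Icc_at)
    from has_vector_derivative_add[OF has_vector_derivative_const[of "y a"] this]
    have "((\<lambda>u. y a + integral {a..u} (\<lambda>s. gt s (x s))) has_vector_derivative gt t (x t)) (at t)"
      by simp
    then show ?thesis
      by (rule has_vector_derivative_transform_within_open[where S = "{a<..<b}"]) (use t x_eq in auto)
  qed
  have x_a: "x a = y a" using x_eq[of a] \<open>a \<le> b\<close> by simp
  define w where "w t = x t - y t" for t
  have w_cont: "continuous_on {a..b} w" unfolding w_def by (intro continuous_intros x_cont y)
  have w_deriv: "(w has_vector_derivative gt t (x t) - y' t) (at t)" if "t \<in> {a<..<b} - S" for t
    unfolding w_def by (intro has_vector_derivative_diff x_deriv y' that)
  have w_a: "w a = 0" by (simp add: w_def x_a)
  have dissip_gt: "w t \<bullet> (gt t (x t) - y' t) \<le> K * (norm (w t))\<^sup>2 + H * norm (w t)" if t: "t \<in> {a..b}" for t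
  proof -
    let ?c = "max R (norm (w t)) / R"
    let ?z = "cut (w t)"
    have "?z \<bullet> (gt t (x t) - y' t) \<le> L t * (norm ?z)\<^sup>2 + G t * norm ?z"
      using dissip[OF t, of "y t + ?z"] by (simp add: gt_def w_def)
    also have "\<dots> \<le> K * (norm ?z)\<^sup>2 + H * norm ?z"
      using K[OF t] H[OF t] by (intro add_mono mult_right_mono) auto
    \<comment> \<open>Only one of the two factors \<open>norm ?z\<close> is enlarged; multiplication
      by \<open>?c\<close> turns the other one into \<open>norm (w t)\<close>. This needs a
      nonnegative coefficient, which is why \<open>K\<close> has replaced
      \<open>L t\<close>.\<close>
    also have "\<dots> \<le> K * (norm ?z * norm (w t)) + H * norm ?z"
      using K0 cut_le(2)[of "w t"]
      by (intro add_mono mult_left_mono order_refl) (auto simp: power2_eq_square intro: mult_left_mono)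
    finally have "?c * (?z \<bullet> (gt t (x t) - y' t)) \<le> ?c * (K * (norm ?z * norm (w t)) + H * norm ?z)"
      using R by (intro mult_left_mono) auto
    also have "\<dots> = K * ((?c * norm ?z) * norm (w t)) + H * (?c * norm ?z)"
      by (simp only: algebra_simps)
    also have "\<dots> = K * (norm (w t))\<^sup>2 + H * norm (w t)"
      unfolding cut_scale(2) by (simp add: power2_eq_square)
    also have "?c * (?z \<bullet> (gt t (x t) - y' t)) = w t \<bullet> (gt t (x t) - y' t)"
      using arg_cong[OF cut_scale(1)[of "w t"], of "\<lambda>v. v \<bullet> (gt t (x t) - y' t)"] by simp
    finally show ?thesis .
  qed
  have w_le: "norm (w t) \<le> R" if t: "t \<in> {a..b}" for t
  proof -
    have sub: "{a..t} \<subseteq> {a..b}" "{a<..<t} \<subseteq> {a<..<b}" using t by auto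
    have "norm (w t) \<le> exp (integral {a..t} (\<lambda>_. K)) * norm (w a)
        + integral {a..t} (\<lambda>s. exp (integral {s..t} (\<lambda>_. K)) * H)"
      using t sub by (intro gronwall_norm[where w' = "\<lambda>t. gt t (x t) - y' t", OF _ \<open>finite S\<close>]
          continuous_on_subset[OF w_cont] w_deriv dissip_gt continuous_intros H0) auto
    also have "\<dots> \<le> 0 + exp (K * (b - a)) * H * (t - a)"
    proof (rule add_mono)
      have "integral {a..t} (\<lambda>s. exp (integral {s..t} (\<lambda>_. K)) * H)
          = integral {a..t} (\<lambda>s. exp (K * (t - s)) * H)"
        by (intro integral_cong) (auto simp: mult.commute)
      also have "\<dots> \<le> integral {a..t} (\<lambda>s. exp (K * (b - a)) * H)"
        using t K0 H0
        by (intro integral_le integrable_continuous_real continuous_intros)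
          (auto intro!: mult_right_mono mult_left_mono)
      also have "\<dots> = exp (K * (b - a)) * H * (t - a)" using t by simp
      finally show "integral {a..t} (\<lambda>s. exp (integral {s..t} (\<lambda>_. K)) * H) \<le> exp (K * (b - a)) * H * (t - a)" .
    qed (simp add: w_a)
    also have "\<dots> \<le> exp (K * (b - a)) * H * (b - a)"
      using t H0 by (simp add: mult_left_mono)
    finally show ?thesis using R by simp
  qed
  have gt_eq: "gt t (x t) = g t (x t)" if "t \<in> {a..b}" for t
    using cut_small[OF w_le[OF that]] by (simp add: gt_def w_def)
  show thesis
  proof (rule that)
    show "x a = y a" by (rule x_a)
    show "(x has_vector_derivative g t (x t)) (at t)" if "t \<in> {a<..<b} - S" for t
      using x_deriv[OF that] gt_eq[of t] that by simp
    show "norm (x t - x s) \<le> B * (t - s)" if "a \<le> s" "s \<le> t" "t \<le> b" for s t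
      using norm_integral_increment_le[OF gt_int gt_bound, of s t] that by (simp add: x_eq)
    show "norm (x t - y t) \<le> integral {a..t} (\<lambda>s. exp (integral {s..t} L) * G s)" if t: "t \<in> {a..b}" for t
    proof -
      have sub: "{a..t} \<subseteq> {a..b}" "{a<..<t} \<subseteq> {a<..<b}" using t by auto
      \<comment> \<open>The truncation is now known to be inactive along \<open>x\<close>, so the
        sharp estimate with \<open>L\<close> and \<open>G\<close> is available and Gronwall is
        applied a second time.\<close>
      have "norm (w t) \<le> exp (integral {a..t} L) * norm (w a)
          + integral {a..t} (\<lambda>s. exp (integral {s..t} L) * G s)"
      proof (rule gronwall_norm[where w' = "\<lambda>t. gt t (x t) - y' t", OF _ \<open>finite S\<close>])
        fix s assume "s \<in> {a<..<t} - S"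
        then have s: "s \<in> {a..b}" using t by auto
        show "w s \<bullet> (gt s (x s) - y' s) \<le> L s * (norm (w s))\<^sup>2 + G s * norm (w s)"
          using dissip[OF s, of "x s"] by (simp add: gt_eq[OF s] w_def)
      qed (use t sub in \<open>auto intro: continuous_on_subset[OF w_cont] continuous_on_subset[OF L]
          continuous_on_subset[OF G] w_deriv G0\<close>)
      then show ?thesis by (simp add: w_def x_a)
    qed
  qed
qed

subsection \<open>Hausdorff continuous set-valued maps\<close>

lemma set_excess_upper:
  assumes "compact A" "a \<in> A"
  shows "infdist a B \<le> set_excess A B"
  unfolding set_excess_def
proof (rule cSUP_upper[OF assms(2)])
  show "bdd_above ((\<lambda>a. infdist a B) ` A)"
    by (intro bounded_imp_bdd_above compact_imp_bounded compact_continuous_image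
        continuous_intros assms)
qed

lemma set_norm_upper:
  assumes "compact A" "a \<in> A"
  shows "norm a \<le> set_norm A"
  unfolding set_norm_def
proof (rule cSUP_upper[OF assms(2)])
  show "bdd_above (norm ` A)"
    by (intro bounded_imp_bdd_above compact_imp_bounded compact_continuous_image
        continuous_intros assms)
qed

lemma set_excess_nonneg:
  assumes "compact A" "A \<noteq> {}"
  shows "0 \<le> set_excess A B"
  using assms set_excess_upper[of A _ B] infdist_nonneg order_trans by (metis ex_in_conv)

lemma hausdorff_dist_nearby_point:
  assumes "compact A" "compact B" "B \<noteq> {}" "a \<in> A"
  obtains b where "b \<in> B" "dist a b \<le> hausdorff_dist A B"
proof -
  obtain b where "b \<in> B" "infdist a B = dist a b"
    using infdist_attains_inf[of B a] assms compact_imp_closed by blast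
  then show thesis
    using that set_excess_upper[of A a B] assms by (auto simp: hausdorff_dist_def)
qed

lemma hausdorff_dist_commute: "hausdorff_dist A B = hausdorff_dist B A"
  by (simp add: hausdorff_dist_def max.commute)

lemma set_norm_le_hausdorff:
  assumes "compact A" "A \<noteq> {}" "compact B" "B \<noteq> {}"
  shows "set_norm A \<le> set_norm B + hausdorff_dist A B"
  unfolding set_norm_def[of A]
proof (rule cSUP_least[OF assms(2)])
  fix a assume "a \<in> A"
  then obtain b where "b \<in> B" "dist a b \<le> hausdorff_dist A B"
    using hausdorff_dist_nearby_point assms by metis
  then show "norm a \<le> set_norm B + hausdorff_dist A B"
    using set_norm_upper[of B b] assms norm_triangle_sub[of a b] by (auto simp: dist_norm)
qed

text \<open>\<open>set_norm\<close> is 1-Lipschitz for the Hausdorff distance. This makes the values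
  of \<open>M\<close> uniformly bounded on compact cylinders.\<close>

lemma continuous_on_set_norm:
  assumes "hausdorff_continuous_on S F" "\<And>p. p \<in> S \<Longrightarrow> compact (F p) \<and> F p \<noteq> {}"
  shows "continuous_on S (\<lambda>p. set_norm (F p))"
  unfolding continuous_on_def
proof
  fix p assume p: "p \<in> S"
  have "((\<lambda>q. set_norm (F q) - set_norm (F p)) \<longlongrightarrow> 0) (at p within S)"
  proof (rule Lim_null_comparison)
    show "((\<lambda>q. hausdorff_dist (F q) (F p)) \<longlongrightarrow> 0) (at p within S)"
      using assms(1) p by (simp add: hausdorff_continuous_on_def)
    show "\<forall>\<^sub>F q in at p within S. norm (set_norm (F q) - set_norm (F p)) \<le> hausdorff_dist (F q) (F p)"
      unfolding eventually_at_filter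
    proof (intro always_eventually allI impI)
      fix q assume "q \<in> S"
      then show "norm (set_norm (F q) - set_norm (F p)) \<le> hausdorff_dist (F q) (F p)"
        using set_norm_le_hausdorff[of "F q" "F p"] set_norm_le_hausdorff[of "F p" "F q"]
          assms(2)[OF p] assms(2)[of q]
        by (auto simp: hausdorff_dist_commute[of "F p" "F q"])
    qed
  qed
  then show "((\<lambda>q. set_norm (F q)) \<longlongrightarrow> set_norm (F p)) (at p within S)"
    by (rule LIM_zero_cancel)
qed

text \<open>The projection \<open>r\<close> onto \<open>B\<close> lies within \<open>h\<close> of
  some \<open>q\<close> in \<open>A\<close>, and \<open>q\<close> is at most \<open>2 * h\<close>
  farther from \<open>m\<close> than the projection \<open>p\<close> onto \<open>A\<close>. By
  convexity of \<open>A\<close> the angle at \<open>p\<close> is obtuse, so the square of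
  \<open>dist q p\<close> is at most the difference of the squared distances of \<open>q\<close> and
  \<open>p\<close> from \<open>m\<close>. With \<open>m\<close> fixed, the projection thus depends
  continuously on the set.\<close>

lemma dist_closest_point_le:
  assumes A: "compact A" "convex A" "A \<noteq> {}" and B: "compact B" "B \<noteq> {}"
  defines "h \<equiv> hausdorff_dist B A"
  shows "dist (closest_point B m) (closest_point A m)
    \<le> h + sqrt (4 * dist m (closest_point A m) * h + 4 * h\<^sup>2)"
proof -
  define p where "p = closest_point A m"
  define r where "r = closest_point B m"
  have cl: "closed A" "closed B" using A B compact_imp_closed by auto
  have pr: "p \<in> A" "r \<in> B" using cl A B by (auto simp: p_def r_def closest_point_in_set)
  obtain q where q: "q \<in> A" "dist r q \<le> h"
    using hausdorff_dist_nearby_point[of B A r] A B pr by (auto simp: h_def)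
  obtain b where b: "b \<in> B" "dist p b \<le> h"
    using hausdorff_dist_nearby_point[of A B p] A B pr
    by (auto simp: h_def hausdorff_dist_commute[of B A])
  have h0: "0 \<le> h" using q(2) zero_le_dist order_trans by blast
  have "dist m r \<le> dist m b" unfolding r_def using cl b by (intro closest_point_le)
  then have "dist m q \<le> dist m p + 2 * h"
    using dist_triangle[of m q r] dist_triangle[of m b p] q b by linarith
  then have "(dist m q)\<^sup>2 \<le> (dist m p + 2 * h)\<^sup>2" by (intro power_mono) auto
  moreover have "(m - p) \<bullet> (q - p) \<le> 0"
    unfolding p_def using A cl q by (intro closest_point_dot)
  then have "(dist m p)\<^sup>2 + (dist q p)\<^sup>2 \<le> (dist m q)\<^sup>2"
    by (simp add: dist_norm power2_norm_eq_inner inner_diff inner_commute algebra_simps)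
  ultimately have "(dist q p)\<^sup>2 \<le> 4 * dist m p * h + 4 * h\<^sup>2"
    by (simp add: power2_eq_square algebra_simps)
  then have "dist q p \<le> sqrt (4 * dist m p * h + 4 * h\<^sup>2)"
    by (rule real_le_rsqrt)
  then show ?thesis
    using dist_triangle[of r p q] q(2) unfolding p_def[symmetric] r_def[symmetric] by linarith
qed

lemma continuous_on_closest_point_hausdorff:
  assumes "hausdorff_continuous_on S F"
    and "\<And>p. p \<in> S \<Longrightarrow> compact (F p) \<and> convex (F p) \<and> F p \<noteq> {}"
  shows "continuous_on S (\<lambda>p. closest_point (F p) m)"
  unfolding continuous_on_def
proof
  fix p assume p: "p \<in> S"
  let ?h = "\<lambda>q. hausdorff_dist (F q) (F p)"
  let ?d = "dist m (closest_point (F p) m)"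
  have h: "(?h \<longlongrightarrow> 0) (at p within S)"
    using assms(1) p by (simp add: hausdorff_continuous_on_def)
  have "((\<lambda>q. closest_point (F q) m - closest_point (F p) m) \<longlongrightarrow> 0) (at p within S)"
  proof (rule Lim_null_comparison)
    have "((\<lambda>q. ?h q + sqrt (4 * ?d * ?h q + 4 * (?h q)\<^sup>2)) \<longlongrightarrow>
        0 + sqrt (4 * ?d * 0 + 4 * 0\<^sup>2)) (at p within S)"
      by (intro tendsto_intros h)
    then show "((\<lambda>q. ?h q + sqrt (4 * ?d * ?h q + 4 * (?h q)\<^sup>2)) \<longlongrightarrow> 0) (at p within S)"
      by simp
    show "\<forall>\<^sub>F q in at p within S. norm (closest_point (F q) m - closest_point (F p) m)
        \<le> ?h q + sqrt (4 * ?d * ?h q + 4 * (?h q)\<^sup>2)"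
      unfolding eventually_at_filter dist_norm[symmetric]
      by (intro always_eventually allI impI dist_closest_point_le) (use assms(2) p in auto)
  qed
  then show "((\<lambda>q. closest_point (F q) m) \<longlongrightarrow> closest_point (F p) m) (at p within S)"
    by (rule LIM_zero_cancel)
qed

lemma lipschitz_imp_absolutely_continuous:
  assumes "\<And>u v. a \<le> u \<Longrightarrow> u \<le> v \<Longrightarrow> v \<le> b \<Longrightarrow> norm (x v - x u) \<le> B * (v - u)"
  shows "absolutely_continuous_on_interval a b x"
  unfolding absolutely_continuous_on_interval_def
proof (intro allI impI)
  fix e :: real assume "e > 0"
  \<comment> \<open>\<open>B\<close> carries no sign, while the choice \<open>e / K\<close> needs a
    positive divisor.\<close>
  define K where "K = max B 1"
  have K: "K \<ge> 1" "K \<ge> B" by (auto simp: K_def)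
  show "\<exists>\<delta>>0. \<forall>I. finite I \<and> (\<forall>(u, v)\<in>I. a \<le> u \<and> u \<le> v \<and> v \<le> b) \<and>
        disjoint_family_on (\<lambda>(u, v). {u<..<v}) I \<and> (\<Sum>(u, v)\<in>I. v - u) < \<delta>
        \<longrightarrow> (\<Sum>(u, v)\<in>I. norm (x v - x u)) < e"
  proof (intro exI[of _ "e / K"] conjI allI impI)
    show "0 < e / K" using K \<open>e > 0\<close> by simp
    fix I assume I: "finite I \<and> (\<forall>(u, v)\<in>I. a \<le> u \<and> u \<le> v \<and> v \<le> b) \<and>
        disjoint_family_on (\<lambda>(u, v). {u<..<v}) I \<and> (\<Sum>(u, v)\<in>I. v - u) < e / K"
    have "(\<Sum>(u, v)\<in>I. norm (x v - x u)) \<le> (\<Sum>(u, v)\<in>I. K * (v - u))"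
    proof (rule sum_mono, clarify)
      fix u v assume "(u, v) \<in> I"
      then have uv: "a \<le> u" "u \<le> v" "v \<le> b" using I by auto
      from assms[OF this] have "norm (x v - x u) \<le> B * (v - u)" .
      also have "\<dots> \<le> K * (v - u)" using uv K by (intro mult_right_mono) auto
      finally show "norm (x v - x u) \<le> K * (v - u)" .
    qed
    also have "\<dots> = K * (\<Sum>(u, v)\<in>I. v - u)" by (simp add: sum_distrib_left case_prod_unfold)
    also have "\<dots> < e" using I K by (simp add: field_simps)
    finally show "(\<Sum>(u, v)\<in>I. norm (x v - x u)) < e" .
  qed
qed

subsection \<open>Grids and polygons\<close>

lemma grid_mono:
  assumes "is_grid T N tt" "i \<le> j" "j \<le> N"
  shows "tt i \<le> tt j"
  using assms(2,3)
proof (induction j rule: dec_induct)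
  case (step j)
  then have "tt i \<le> tt j" "tt j < tt (Suc j)" using assms(1) by (auto simp: is_grid_def)
  then show ?case by simp
qed simp

text \<open>The intervals are taken left-open, so a grid point \<open>tt (Suc k)\<close> belongs to the step with
  index \<open>k\<close>; only \<open>0\<close> belongs to the step starting at it.\<close>

definition grid_index :: "(nat \<Rightarrow> real) \<Rightarrow> real \<Rightarrow> nat" where
  "grid_index tt t = (LEAST k. t \<le> tt (Suc k))"

lemma grid_index:
  assumes grid: "is_grid T N tt" and T: "T > 0" and t: "t \<in> {0..T}"
  shows "grid_index tt t < N" "tt (grid_index tt t) \<le> t" "t \<le> tt (Suc (grid_index tt t))"
proof -
  \<comment> \<open>A positive \<open>T\<close> forces at least one step, so \<open>N - 1\<close> is
    the last index and a witness for the \<open>LEAST\<close>.\<close>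
  have N: "N > 0" using grid T by (cases N) (auto simp: is_grid_def)
  then have ex: "t \<le> tt (Suc (N - 1))" using grid t by (simp add: is_grid_def)
  show "t \<le> tt (Suc (grid_index tt t))" unfolding grid_index_def by (rule LeastI[of _ "N - 1"]) (rule ex)
  have "grid_index tt t \<le> N - 1" unfolding grid_index_def by (rule Least_le) (rule ex)
  then show "grid_index tt t < N" using N by simp
  show "tt (grid_index tt t) \<le> t"
  proof (cases "grid_index tt t")
    case 0
    then show ?thesis using grid t by (simp add: is_grid_def)
  next
    case (Suc j)
    then have "\<not> t \<le> tt (Suc j)"
      using not_less_Least[of j "\<lambda>k. t \<le> tt (Suc k)"] by (auto simp: grid_index_def)
    then show ?thesis using Suc by simp
  qed
qed

lemma grid_index_eq:
  assumes grid: "is_grid T N tt" and k: "k < N" and t: "tt k < t" "t \<le> tt (Suc k)"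
  shows "grid_index tt t = k"
  unfolding grid_index_def
proof (rule Least_equality)
  fix j assume j: "t \<le> tt (Suc j)"
  show "k \<le> j"
  proof (rule ccontr)
    assume "\<not> k \<le> j"
    then have "tt (Suc j) \<le> tt k" using k by (intro grid_mono[OF grid]) auto
    then show False using j t by simp
  qed
qed (use t in simp)

lemma grid_nonneg: "is_grid T N tt \<Longrightarrow> k \<le> N \<Longrightarrow> 0 \<le> tt k"
  using grid_mono[of T N tt 0 k] by (simp add: is_grid_def)

lemma grid_le: "is_grid T N tt \<Longrightarrow> k \<le> N \<Longrightarrow> tt k \<le> T"
  using grid_mono[of T N tt k N] by (simp add: is_grid_def)

text \<open>On the step with index \<open>n\<close> the integrand equals the continuous
  \<open>F n\<close>, except possibly at the left end, which \<open>grid_index\<close> assigns to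
  the step before. One point does not affect the integral, so jumps at grid points are
  harmless.\<close>

lemma piecewise_continuous_integrable:
  fixes F :: "nat \<Rightarrow> real \<Rightarrow> 'a::euclidean_space"
  assumes grid: "is_grid T N tt"
    and F: "\<And>k. k < N \<Longrightarrow> continuous_on {tt k..tt (Suc k)} (F k)"
  shows "(\<lambda>s. F (grid_index tt s) s) integrable_on {0..T}"
proof -
  have "(\<lambda>s. F (grid_index tt s) s) integrable_on {0..tt n}" if "n \<le> N" for n
    using that
  proof (induction n)
    case 0
    then show ?case using grid integrable_on_refl[of _ "0::real"] by (simp add: is_grid_def)
  next
    case (Suc n)
    have "(\<lambda>s. F (grid_index tt s) s) integrable_on {tt n..tt (Suc n)}"
    proof (rule integrable_spike_finite[of "{tt n}"])
      show "F n integrable_on {tt n..tt (Suc n)}"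
        using F[of n] Suc.prems by (intro integrable_continuous_real) auto
      show "F (grid_index tt s) s = F n s" if "s \<in> {tt n..tt (Suc n)} - {tt n}" for s
        using grid_index_eq[OF grid, of n s] that Suc.prems by auto
    qed auto
    then show ?case
      using grid_nonneg[OF grid, of n] grid_mono[OF grid, of n "Suc n"] Suc
      by (intro Henstock_Kurzweil_Integration.integrable_combine[of 0 "tt n" "tt (Suc n)"]) auto
  qed
  from this[of N] show ?thesis using grid by (simp add: is_grid_def)
qed

text \<open>Off the grid points \<open>grid_index tt\<close> is locally constant, so continuity and
  derivatives can be read off a single piece.\<close>

lemma grid_open_piece:
  assumes grid: "is_grid T N tt" and T: "T > 0" and t: "t \<in> {0<..<T} - tt ` {..N}"
  obtains k where "k < N" "t \<in> {tt k<..<tt (Suc k)}"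
    "\<And>s. s \<in> {tt k<..<tt (Suc k)} \<Longrightarrow> grid_index tt s = k"
proof
  define k where "k = grid_index tt t"
  have "t \<in> {0..T}" using t by simp
  note k = grid_index[OF grid T this, folded k_def]
  show "k < N" by (rule k)
  have "t \<noteq> tt k" "t \<noteq> tt (Suc k)" using t k(1) by auto
  with k show "t \<in> {tt k<..<tt (Suc k)}" by auto
  show "grid_index tt s = k" if "s \<in> {tt k<..<tt (Suc k)}" for s
    using grid_index_eq[OF grid k(1), of s] that by auto
qed

lemma piecewise_continuous_isCont:
  fixes F :: "nat \<Rightarrow> real \<Rightarrow> 'a::topological_space"
  assumes grid: "is_grid T N tt" and T: "T > 0"
    and F: "\<And>k. k < N \<Longrightarrow> continuous_on {tt k..tt (Suc k)} (F k)"
    and t: "t \<in> {0<..<T} - tt ` {..N}"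
  shows "isCont (\<lambda>s. F (grid_index tt s) s) t"
proof -
  obtain k where k: "k < N" "t \<in> {tt k<..<tt (Suc k)}"
    and idx: "\<And>s. s \<in> {tt k<..<tt (Suc k)} \<Longrightarrow> grid_index tt s = k"
    using grid_open_piece[OF grid T t] by metis
  have "continuous_on {tt k<..<tt (Suc k)} (F k)"
    by (rule continuous_on_subset[OF F[OF k(1)]]) auto
  then have "continuous_on {tt k<..<tt (Suc k)} (\<lambda>s. F (grid_index tt s) s)"
    by (rule continuous_on_eq) (simp only: idx)
  then show ?thesis using k(2) by (simp add: continuous_on_eq_continuous_at)
qed

text \<open>Slopes are given instead of right end values, so that the derivative off the grid is
  \<open>v k\<close> by construction. Continuity at the grid points comes from the recursion linking
  \<open>y\<close> and \<open>v\<close>.\<close>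

definition polygon :: "(nat \<Rightarrow> real) \<Rightarrow> (nat \<Rightarrow> 'a::real_normed_vector) \<Rightarrow> (nat \<Rightarrow> 'a) \<Rightarrow> real \<Rightarrow> 'a" where
  "polygon tt y v t = (let k = grid_index tt t in y k + (t - tt k) *\<^sub>R v k)"

text \<open>For positive \<open>k\<close> the definition evaluates \<open>tt k\<close> with the
  formula of the preceding step; the recursion for \<open>y\<close> makes the two formulas agree
  there, so each formula holds on its closed step.\<close>

lemma polygon_on_piece:
  assumes grid: "is_grid T N tt"
    and y: "\<And>k. k < N \<Longrightarrow> y (Suc k) = y k + step_size tt k *\<^sub>R v k"
    and k: "k < N" and t: "t \<in> {tt k..tt (Suc k)}"
  shows "polygon tt y v t = y k + (t - tt k) *\<^sub>R v k"
proof (cases "t = tt k")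
  case False
  then show ?thesis using grid_index_eq[OF grid k, of t] t by (simp add: polygon_def)
next
  case True
  show ?thesis
  proof (cases k)
    case 0
    have "grid_index tt 0 = 0"
      using grid grid_mono[OF grid, of 0 "Suc 0"] k
      unfolding grid_index_def by (intro Least_equality) (auto simp: is_grid_def)
    then show ?thesis using True 0 grid by (simp add: polygon_def is_grid_def)
  next
    case (Suc j)
    have "grid_index tt (tt (Suc j)) = j"
      using grid_index_eq[OF grid, of j "tt (Suc j)"] grid k Suc by (auto simp: is_grid_def)
    then show ?thesis using True Suc y[of j] k by (simp add: polygon_def step_size_def)
  qed
qed

lemma polygon_at_grid:
  assumes grid: "is_grid T N tt" and T: "T > 0"
    and y: "\<And>k. k < N \<Longrightarrow> y (Suc k) = y k + step_size tt k *\<^sub>R v k"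
    and k: "k \<le> N"
  shows "polygon tt y v (tt k) = y k"
proof (cases "k < N")
  case True
  then show ?thesis
    using polygon_on_piece[OF grid y True, of "tt k"] grid by (simp add: is_grid_def less_imp_le)
next
  case False
  have "N > 0" using grid T by (cases N) (auto simp: is_grid_def)
  then obtain j where j: "k = Suc j" "j < N" using False k by (cases k) auto
  then show ?thesis
    using polygon_on_piece[OF grid y j(2), of "tt k"] grid y[of j]
    by (simp add: is_grid_def less_imp_le step_size_def)
qed

lemma continuous_on_polygon:
  assumes grid: "is_grid T N tt" and T: "T > 0"
    and y: "\<And>k. k < N \<Longrightarrow> y (Suc k) = y k + step_size tt k *\<^sub>R v k"
  shows "continuous_on {0..T} (polygon tt y v)"
proof -
  have "continuous_on {tt k..tt (Suc k)} (polygon tt y v)" if "k < N" for k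
    by (rule continuous_on_eq[of _ "\<lambda>t. y k + (t - tt k) *\<^sub>R v k"])
      (auto intro!: continuous_intros simp: polygon_on_piece[where N = N, OF grid y that])
  then have "continuous_on (\<Union>k\<in>{..<N}. {tt k..tt (Suc k)}) (polygon tt y v)"
    by (intro continuous_on_closed_Union) auto
  moreover have "{0..T} \<subseteq> (\<Union>k\<in>{..<N}. {tt k..tt (Suc k)})"
    using grid_index[OF grid T] by fastforce
  ultimately show ?thesis by (rule continuous_on_subset)
qed

lemma has_vector_derivative_polygon:
  assumes grid: "is_grid T N tt" and T: "T > 0" and t: "t \<in> {0<..<T} - tt ` {..N}"
  shows "(polygon tt y v has_vector_derivative v (grid_index tt t)) (at t)"
proof -
  obtain k where k: "t \<in> {tt k<..<tt (Suc k)}"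
    and idx: "\<And>s. s \<in> {tt k<..<tt (Suc k)} \<Longrightarrow> grid_index tt s = k"
    using grid_open_piece[OF grid T t] by metis
  have "((\<lambda>s. y k + (s - tt k) *\<^sub>R v k) has_vector_derivative v k) (at t)"
    by (auto intro!: derivative_eq_intros)
  then have "(polygon tt y v has_vector_derivative v k) (at t)"
    by (rule has_vector_derivative_transform_within_open[OF _ _ k]) (simp_all add: polygon_def idx)
  then show ?thesis by (simp only: idx[OF k])
qed

subsection \<open>Bounds for the data and the error estimate\<close>

lemma bounded_on_cylinder:
  fixes g :: "real \<Rightarrow> 'a::euclidean_space \<Rightarrow> 'b::real_normed_vector"
  assumes "continuous_on ({0..T} \<times> UNIV) (\<lambda>(t, x). g t x)"
  shows "\<exists>B. \<forall>t\<in>{0..T}. \<forall>x\<in>cball 0 R. norm (g t x) \<le> B"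
proof -
  have cpt: "compact ((\<lambda>(t, x). g t x) ` ({0..T} \<times> cball 0 R))"
    by (intro compact_continuous_image continuous_on_subset[OF assms] compact_Times) auto
  obtain B where "\<forall>z\<in>(\<lambda>(t, x). g t x) ` ({0..T} \<times> cball 0 R). norm z \<le> B"
    using compact_imp_bounded[OF cpt] unfolding bounded_iff by blast
  then show ?thesis by (intro exI[of _ B]) auto
qed

text \<open>A crude bound that makes the supremum in \<open>tau_M\<close> finite.\<close>

lemma set_excess_le:
  assumes "A \<noteq> {}" "B \<noteq> {}" "compact A" "compact B"
  shows "set_excess A B \<le> set_norm A + set_norm B"
  unfolding set_excess_def
proof (rule cSUP_least[OF assms(1)])
  fix a assume a: "a \<in> A"
  obtain b where b: "b \<in> B" using assms(2) by blast
  have "infdist a B \<le> dist a b" by (rule infdist_le[OF b])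
  also have "\<dots> \<le> norm a + norm b" by (simp add: dist_norm norm_triangle_ineq4)
  also have "\<dots> \<le> set_norm A + set_norm B"
    using assms a b by (intro add_mono set_norm_upper)
  finally show "infdist a B \<le> set_norm A + set_norm B" .
qed

text \<open>A real \<open>Sup\<close> dominates the elements of a set only if the set is bounded
  above; compactness of the cylinder supplies that bound. \<open>chi_f\<close> and
  \<open>tau_M\<close> are treated alike.\<close>

lemma tau_f_upper:
  assumes f: "continuous_on ({0..T} \<times> UNIV) (\<lambda>(t, x). f t x)"
    and "t \<in> {0..T}" "t' \<in> {0..T}" "\<bar>t - t'\<bar> \<le> \<delta>" "x \<in> cball 0 C"
  shows "norm (f t x - f t' x) \<le> tau_f f T C \<delta>"
  unfolding tau_f_def
proof (rule cSup_upper)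
  obtain B where B: "\<And>t x. t \<in> {0..T} \<Longrightarrow> x \<in> cball 0 C \<Longrightarrow> norm (f t x) \<le> B"
    using bounded_on_cylinder[OF f] by blast
  have le: "norm (f t x - f t' x) \<le> B + B" if "t \<in> {0..T}" "t' \<in> {0..T}" "x \<in> cball 0 C" for t t' x
    by (rule order_trans[OF norm_triangle_ineq4 add_mono]) (intro B that)+
  show "bdd_above {norm (f t x - f t' x) | t t' x.
      t \<in> {0..T} \<and> t' \<in> {0..T} \<and> \<bar>t - t'\<bar> \<le> \<delta> \<and> x \<in> cball 0 C}"
    using le by (intro bdd_aboveI[of _ "B + B"]) blast
qed (use assms in blast)

lemma chi_f_upper:
  assumes f: "continuous_on ({0..T} \<times> UNIV) (\<lambda>(t, x). f t x)"
    and "t \<in> {0..T}" "x \<in> cball 0 C" "x' \<in> cball 0 C" "norm (x - x') \<le> \<delta>"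
  shows "norm (f t x - f t x') \<le> chi_f f T C \<delta>"
  unfolding chi_f_def
proof (rule cSup_upper)
  obtain B where B: "\<And>t x. t \<in> {0..T} \<Longrightarrow> x \<in> cball 0 C \<Longrightarrow> norm (f t x) \<le> B"
    using bounded_on_cylinder[OF f] by blast
  have le: "norm (f t x - f t x') \<le> B + B" if "t \<in> {0..T}" "x \<in> cball 0 C" "x' \<in> cball 0 C" for t x x'
    by (rule order_trans[OF norm_triangle_ineq4 add_mono]) (intro B that)+
  show "bdd_above {norm (f t x - f t x') | t x x'.
      t \<in> {0..T} \<and> x \<in> cball 0 C \<and> x' \<in> cball 0 C \<and> norm (x - x') \<le> \<delta>}"
    using le by (intro bdd_aboveI[of _ "B + B"]) blast
qed (use assms in blast)

lemma set_norm_bounded_on_cylinder: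
  fixes M :: "real \<Rightarrow> 'a::euclidean_space \<Rightarrow> 'a set"
  assumes M: "hausdorff_continuous_on ({0..T} \<times> UNIV) (\<lambda>(t, x). M t x)"
    and val: "\<And>t x. t \<in> {0..T} \<Longrightarrow> compact (M t x) \<and> M t x \<noteq> {}"
  shows "\<exists>B. \<forall>t\<in>{0..T}. \<forall>x\<in>cball 0 R. norm (set_norm (M t x)) \<le> B"
proof (rule bounded_on_cylinder[of T "\<lambda>t x. set_norm (M t x)" R])
  show "continuous_on ({0..T} \<times> UNIV) (\<lambda>(t, x). set_norm (M t x))"
    using continuous_on_set_norm[OF M] val by (simp add: case_prod_unfold mem_Times_iff)
qed

lemma tau_M_upper:
  assumes M: "hausdorff_continuous_on ({0..T} \<times> UNIV) (\<lambda>(t, x). M t x)"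
    and val: "\<And>t x. t \<in> {0..T} \<Longrightarrow> compact (M t x) \<and> M t x \<noteq> {}"
    and "t \<in> {0..T}" "t' \<in> {0..T}" "\<bar>t - t'\<bar> \<le> \<delta>" "x \<in> cball 0 C"
  shows "set_excess (M t x) (M t' x) \<le> tau_M M T C \<delta>"
  unfolding tau_M_def
proof (rule cSup_upper)
  obtain B where B: "\<And>t x. t \<in> {0..T} \<Longrightarrow> x \<in> cball 0 C \<Longrightarrow> norm (set_norm (M t x)) \<le> B"
    using set_norm_bounded_on_cylinder[OF M val] by blast
  have "set_excess (M t x) (M t' x) \<le> B + B" if "t \<in> {0..T}" "t' \<in> {0..T}" "x \<in> cball 0 C" for t t' x
    using set_excess_le[of "M t x" "M t' x"] val[OF that(1)] val[OF that(2)] B[OF that(1,3)] B[OF that(2,3)]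
    by fastforce
  then show "bdd_above {set_excess (M t x) (M t' x) | t t' x.
      t \<in> {0..T} \<and> t' \<in> {0..T} \<and> \<bar>t - t'\<bar> \<le> \<delta> \<and> x \<in> cball 0 C}"
    by (intro bdd_aboveI[of _ "B + B"]) blast
qed (use assms in blast)

text \<open>\<open>f\<close> and \<open>M\<close> may be evaluated at different points, since a
  slope of the scheme combines \<open>f\<close> at the new node with an element of \<open>M\<close>
  at the old one. The two separate suprema in \<open>P_const\<close> allow this.\<close>

lemma P_const_upper:
  assumes f: "continuous_on ({0..T} \<times> UNIV) (\<lambda>(t, x). f t x)"
    and M: "hausdorff_continuous_on ({0..T} \<times> UNIV) (\<lambda>(t, x). M t x)"
    and val: "\<And>t x. t \<in> {0..T} \<Longrightarrow> compact (M t x) \<and> M t x \<noteq> {}"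
    and tx: "t \<in> {0..T}" "x \<in> cball 0 C" and tx': "t' \<in> {0..T}" "x' \<in> cball 0 C"
    and m: "m \<in> M t' x'"
  shows "norm (f t x + m) \<le> P_const f M T C"
proof -
  obtain Bf where Bf: "\<And>t x. t \<in> {0..T} \<Longrightarrow> x \<in> cball 0 C \<Longrightarrow> norm (f t x) \<le> Bf"
    using bounded_on_cylinder[OF f] by blast
  obtain BM where BM: "\<And>t x. t \<in> {0..T} \<Longrightarrow> x \<in> cball 0 C \<Longrightarrow> norm (set_norm (M t x)) \<le> BM"
    using set_norm_bounded_on_cylinder[OF M val] by blast
  let ?D = "{0..T} \<times> cball (0::'a) C"
  have "norm (f t x) \<le> (SUP (t, x)\<in>?D. norm (f t x))"
  proof (rule cSUP_upper2[where x = "(t, x)"])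
    show "bdd_above ((\<lambda>(t, x). norm (f t x)) ` ?D)"
      by (rule bdd_aboveI[of _ Bf]) (use Bf in auto)
  qed (use tx in auto)
  moreover have "set_norm (M t' x') \<le> (SUP (t, x)\<in>?D. set_norm (M t x))"
  proof (rule cSUP_upper2[where x = "(t', x')"])
    show "bdd_above ((\<lambda>(t, x). set_norm (M t x)) ` ?D)"
      by (rule bdd_aboveI[of _ BM]) (use BM abs_le_D1 in \<open>fastforce\<close>)
  qed (use tx' in auto)
  ultimately show ?thesis
    using norm_triangle_ineq[of "f t x" m] set_norm_upper[OF conjunct1[OF val[OF tx'(1)]] m]
    unfolding P_const_def by linarith
qed

lemma AE_lebesgue_on_finite_exception:
  assumes "finite S" "\<And>t. t \<in> {a..b} - S \<Longrightarrow> Q t"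
  shows "AE t in lebesgue_on {a..b::real}. Q t"
proof -
  have "S \<in> null_sets lebesgue"
    using finite_imp_null_set_lborel[OF assms(1)] by (rule null_sets_completionI)
  then have "AE t in lebesgue. t \<notin> S" by (rule AE_not_in)
  then have "AE t in lebesgue. t \<in> {a..b} \<longrightarrow> Q t"
    by (rule AE_mp) (use assms(2) in auto)
  then show ?thesis by (subst AE_restrict_space_iff) auto
qed

section \<open>A solution of the inclusion near the given trajectory\<close>

theorem corollary17:
  fixes f :: "real \<Rightarrow> 'a::euclidean_space \<Rightarrow> 'a"
    and M :: "real \<Rightarrow> 'a \<Rightarrow> 'a set"
    and l_f L_M :: "real \<Rightarrow> real"
    and T C :: real
    and x0 :: 'a
    and N :: nat
    and tt :: "nat \<Rightarrow> real"
  assumes T_pos: "T > 0"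
    and A1_cont: "continuous_on ({0..T} \<times> UNIV) (\<lambda>(t, x). f t x)"
    and A1_l_f: "continuous_on {0..T} l_f"
    and A1_osl: "\<And>t x x'. t \<in> {0..T} \<Longrightarrow>
                   (f t x - f t x') \<bullet> (x - x') \<le> l_f t * (norm (x - x'))\<^sup>2"
    and A2_values: "\<And>t x. t \<in> {0..T} \<Longrightarrow> M t x \<noteq> {} \<and> convex (M t x) \<and> compact (M t x)"
    and A2_cont: "hausdorff_continuous_on ({0..T} \<times> UNIV) (\<lambda>(t, x). M t x)"
    and A2_L_M: "continuous_on {0..T} L_M" "\<And>t. t \<in> {0..T} \<Longrightarrow> L_M t \<ge> 0"
    and A2_lip: "\<And>t x x'. t \<in> {0..T} \<Longrightarrow>
                   hausdorff_dist (M t x) (M t x') \<le> L_M t * norm (x - x')"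
    and grid: "is_grid T N tt"
    and A3: "\<And>n. n < N \<Longrightarrow> l_f (tt (Suc n)) * step_size tt n < 1"
    and C_pos: "C > 0"
    and C_solutions: "\<And>x t. di_solution (rhs f M) T x0 x \<Longrightarrow> t \<in> {0..T} \<Longrightarrow> x t \<in> cball 0 C"
    and C_trajectories: "\<And>y n. euler_trajectory f M N tt x0 y \<Longrightarrow> n \<le> N \<Longrightarrow> y n \<in> cball 0 C"
  shows "\<forall>y. euler_trajectory f M N tt x0 y \<longrightarrow>
           (\<exists>x. di_solution (rhs f M) T x0 x \<and>
             (\<forall>n\<le>N. norm (x (tt n) - y n)
                \<le> integral {0..tt n} (\<lambda>t.
                     exp (integral {t..tt n} (\<lambda>s. l_f s + L_M s))
                       * Gamma_err f M L_M T C (max_step N tt) t)))"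
proof (intro allI impI)
  fix Y assume traj: "euler_trajectory f M N tt x0 Y"
  have Y_C: "Y k \<in> cball 0 C" if "k \<le> N" for k by (rule C_trajectories[OF traj that])
  have tt_T: "tt k \<in> {0..T}" if "k \<le> N" for k
    using grid_nonneg[OF grid that] grid_le[OF grid that] by simp
  have val: "compact (M t x) \<and> M t x \<noteq> {}" if "t \<in> {0..T}" for t x using A2_values[OF that] by blast
  have "\<forall>k. \<exists>m. k < N \<longrightarrow> m \<in> M (tt k) (Y k) \<and>
      Y (Suc k) = Y k + step_size tt k *\<^sub>R f (tt (Suc k)) (Y (Suc k)) + step_size tt k *\<^sub>R m"
    using traj by (fastforce simp: euler_trajectory_def euler_step_def step_size_def)
  then obtain m where m: "\<And>k. k < N \<Longrightarrow> m k \<in> M (tt k) (Y k)"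
    and Y_Suc': "\<And>k. k < N \<Longrightarrow>
      Y (Suc k) = Y k + step_size tt k *\<^sub>R f (tt (Suc k)) (Y (Suc k)) + step_size tt k *\<^sub>R m k"
    by metis
  define v where "v k = f (tt (Suc k)) (Y (Suc k)) + m k" for k
  have Y_Suc: "Y (Suc k) = Y k + step_size tt k *\<^sub>R v k" if "k < N" for k
    using Y_Suc'[OF that] by (simp add: v_def scaleR_add_right add.assoc)
  let ?P = "P_const f M T C" and ?h = "max_step N tt"
  let ?G = "Gamma_err f M L_M T C ?h"
  have v_P: "norm (v k) \<le> ?P" if "k < N" for k
    unfolding v_def
    using that by (intro P_const_upper[OF A1_cont A2_cont val _ _ _ _ m[OF that]] tt_T Y_C) auto
  have step_h: "step_size tt k \<le> ?h" if "k < N" for k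
    unfolding max_step_def using that by (intro Max_ge) auto
  have step_pos: "0 < step_size tt k" if "k < N" for k
    using grid that by (simp add: is_grid_def step_size_def)
  have N_pos: "0 < N" using grid T_pos by (cases N) (auto simp: is_grid_def)
  have h0: "0 \<le> ?h" using step_h[OF N_pos] step_pos[OF N_pos] by simp
  have P0: "0 \<le> ?P" using v_P[OF N_pos] norm_ge_zero order_trans by blast
  note tau_f = tau_f_upper[OF A1_cont] and chi_f = chi_f_upper[OF A1_cont]
  have tau_M: "set_excess (M t x) (M t' x) \<le> tau_M M T C \<delta>"
    if "t \<in> {0..T}" "t' \<in> {0..T}" "\<bar>t - t'\<bar> \<le> \<delta>" "x \<in> cball 0 C" for t t' x \<delta>
    using val that by (intro tau_M_upper[OF A2_cont]) auto
  have G0: "0 \<le> ?G t" if t: "t \<in> {0..T}" for t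
  proof -
    have "0 \<le> tau_f f T C ?h" using tau_f[of t t ?h 0 C] t h0 C_pos by simp
    moreover have "0 \<le> chi_f f T C (?P * ?h)"
      using chi_f[of t 0 C 0 "?P * ?h"] t h0 P0 C_pos by simp
    moreover have "0 \<le> set_excess (M t 0) (M t 0)" using val[OF t] by (intro set_excess_nonneg) auto
    then have "0 \<le> tau_M M T C ?h" using tau_M[of t t ?h 0] t h0 C_pos by simp
    ultimately show ?thesis
      unfolding Gamma_err_def using A2_L_M(2)[OF t] h0 P0 by (intro add_nonneg_nonneg mult_nonneg_nonneg)
  qed

  \<comment> \<open>Continuity of the selected right-hand side along paths\<close>
  define y where "y = polygon tt Y v"
  define g where "g t x = f t x + closest_point (M t x) (m (grid_index tt t))" for t x
  have f_path: "continuous_on A (\<lambda>s. f s (X s))" if "A \<subseteq> {0..T}" "continuous_on A X" for A X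
  proof -
    have "continuous_on A (\<lambda>s. (\<lambda>(t, x). f t x) (s, X s))"
      by (rule continuous_on_compose2[OF A1_cont]) (use that in \<open>auto intro!: continuous_intros\<close>)
    then show ?thesis by simp
  qed
  have proj_cont: "continuous_on ({0..T} \<times> UNIV) (\<lambda>p. closest_point ((\<lambda>(t, x). M t x) p) q)" for q
    by (rule continuous_on_closest_point_hausdorff[OF A2_cont]) (use A2_values in auto)
  have proj_path: "continuous_on A (\<lambda>s. closest_point (M s (X s)) q)"
    if "A \<subseteq> {0..T}" "continuous_on A X" for A X q
  proof -
    have "continuous_on A (\<lambda>s. (\<lambda>p. closest_point ((\<lambda>(t, x). M t x) p) q) (s, X s))"
      by (rule continuous_on_compose2[OF proj_cont]) (use that in \<open>auto intro!: continuous_intros\<close>)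
    then show ?thesis by simp
  qed
  have piece: "continuous_on {tt k..tt (Suc k)} (\<lambda>s. f s (X s) + closest_point (M s (X s)) (m k))"
    if "continuous_on {0..T} X" "k < N" for X k
  proof -
    have "{tt k..tt (Suc k)} \<subseteq> {0..T}" using tt_T[of k] tt_T[of "Suc k"] that(2) by auto
    then show ?thesis
      using continuous_on_subset[OF that(1)] by (intro continuous_on_add f_path proj_path)
  qed
  have dissip: "(x - y t) \<bullet> (g t x - v (grid_index tt t))
      \<le> (l_f t + L_M t) * (norm (x - y t))\<^sup>2 + ?G t * norm (x - y t)" if t: "t \<in> {0..T}" for t x
  proof -
    define k where "k = grid_index tt t"
    note k = grid_index[OF grid T_pos t, folded k_def]
    define p where "p = closest_point (M t x) (m k)"
    define w where "w = x - y t"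
    have kT: "tt k \<in> {0..T}" "tt (Suc k) \<in> {0..T}" using tt_T k by auto
    have close: "\<bar>t - tt (Suc k)\<bar> \<le> ?h" "\<bar>tt k - t\<bar> \<le> ?h"
      using step_h[OF k(1)] k by (auto simp: step_size_def)
    have y_eq: "y t = Y k + (t - tt k) *\<^sub>R v k"
      by (simp add: y_def polygon_def k_def Let_def)
    \<comment> \<open>The scheme takes \<open>f\<close> at the right node and \<open>M\<close> at
      the left one, so the distance of the polygon to both nodes is required.\<close>
    have y_eq': "y t - Y (Suc k) = (t - tt (Suc k)) *\<^sub>R v k"
      unfolding y_eq Y_Suc[OF k(1)] step_size_def by (simp add: algebra_simps)
    have scaled: "norm (r *\<^sub>R v k) \<le> ?P * ?h" if "\<bar>r\<bar> \<le> ?h" for r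
    proof -
      have "\<bar>r\<bar> * norm (v k) \<le> ?h * ?P" using that v_P[OF k(1)] h0 by (intro mult_mono) auto
      then show ?thesis by (simp add: mult.commute)
    qed
    have y_dist: "norm (Y k - y t) \<le> ?P * ?h" "norm (y t - Y (Suc k)) \<le> ?P * ?h"
      using scaled[of "t - tt k"] scaled[of "t - tt (Suc k)"] close
      by (simp_all add: y_eq abs_minus_commute) (simp add: y_eq' y_eq[symmetric])
    \<comment> \<open>On a step the polygon is a convex combination of two nodes in the ball, so it
      stays in the ball, where \<open>tau_f\<close> and \<open>chi_f\<close> apply.\<close>
    let ?\<theta> = "(t - tt k) / step_size tt k"
    have "(1 - r) *\<^sub>R Y k + r *\<^sub>R Y (Suc k) = Y k + (r * step_size tt k) *\<^sub>R v k" for r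
      unfolding Y_Suc[OF k(1)] by (simp add: algebra_simps)
    then have "y t = (1 - ?\<theta>) *\<^sub>R Y k + ?\<theta> *\<^sub>R Y (Suc k)"
      using step_pos[OF k(1)] by (simp add: y_eq)
    moreover have "0 \<le> ?\<theta>" "?\<theta> \<le> 1"
      using k step_pos[OF k(1)] by (auto simp: step_size_def)
    ultimately have y_C: "y t \<in> cball 0 C"
      using convexD_alt[OF convex_cball Y_C Y_C, of k "Suc k" ?\<theta>] k(1) by simp
    have f_err: "norm (f t (y t) - f (tt (Suc k)) (Y (Suc k)))
        \<le> tau_f f T C ?h + chi_f f T C (?P * ?h)"
      using norm_triangle_ineq[of "f t (y t) - f (tt (Suc k)) (y t)"
          "f (tt (Suc k)) (y t) - f (tt (Suc k)) (Y (Suc k))"]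
        tau_f[OF t kT(2) close(1) y_C] chi_f[OF kT(2) y_C Y_C y_dist(2)] k(1)
      by simp
    \<comment> \<open>From \<open>m k\<close> the path to \<open>M t x\<close> first changes time at
      the state \<open>Y k\<close> and only then the state. As \<open>x\<close> is arbitrary and may
      lie outside the ball, \<open>tau_M\<close> is usable only at \<open>Y k\<close>; the change of
      state is left to the global Lipschitz condition.\<close>
    obtain q where q: "q \<in> M t (Y k)" "infdist (m k) (M t (Y k)) = dist (m k) q"
      using infdist_attains_inf[of "M t (Y k)" "m k"] val[OF t] compact_imp_closed by blast
    have "dist (m k) q \<le> set_excess (M (tt k) (Y k)) (M t (Y k))"
      unfolding q(2)[symmetric] using val[OF kT(1)] m[OF k(1)] by (intro set_excess_upper) auto
    also have "\<dots> \<le> tau_M M T C ?h"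
      using tau_M[OF kT(1) t close(2) Y_C] k(1) by simp
    finally have mq: "dist (m k) q \<le> tau_M M T C ?h" .
    obtain r where r: "r \<in> M t x" "dist q r \<le> hausdorff_dist (M t (Y k)) (M t x)"
      using hausdorff_dist_nearby_point[of "M t (Y k)" "M t x" q] val[OF t] q(1) by auto
    note r(2)
    also have "\<dots> \<le> L_M t * norm (Y k - x)" by (rule A2_lip[OF t])
    also have "\<dots> \<le> L_M t * (?P * ?h + norm w)"
      using A2_L_M(2)[OF t] norm_triangle_ineq[of "Y k - y t" "y t - x"] y_dist(1)
      by (intro mult_left_mono) (auto simp: w_def norm_minus_commute)
    finally have qr: "dist q r \<le> L_M t * ?P * ?h + L_M t * norm w" by (simp add: algebra_simps)
    \<comment> \<open>\<open>r\<close> depends on \<open>x\<close> and \<open>t\<close> with no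
      control, but the projection \<open>p\<close> is at least as close to \<open>m k\<close> and
      therefore inherits the estimate.\<close>
    have "dist (m k) p \<le> dist (m k) r"
      unfolding p_def using val[OF t] r(1) by (intro closest_point_le compact_imp_closed) auto
    then have p_err: "norm (p - m k) \<le> tau_M M T C ?h + L_M t * ?P * ?h + L_M t * norm w"
      using dist_triangle[of "m k" r q] mq qr by (simp add: dist_norm norm_minus_commute)
    \<comment> \<open>The first term is dissipative, the second is the defect of \<open>f\<close> at
      the nodes, the third that of the selection. The part \<open>L_M t * norm w\<close> of the last
      joins \<open>l_f t\<close> in the quadratic coefficient; all other errors make up
      \<open>?G t\<close>.\<close>
    have "w \<bullet> (g t x - v k) = (f t x - f t (y t)) \<bullet> w
        + w \<bullet> (f t (y t) - f (tt (Suc k)) (Y (Suc k))) + w \<bullet> (p - m k)"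
      by (simp add: g_def v_def p_def k_def[symmetric] inner_diff_right inner_add_right
          inner_diff_left inner_commute)
    also have "\<dots> \<le> l_f t * (norm w)\<^sup>2 + norm w * (tau_f f T C ?h + chi_f f T C (?P * ?h))
        + norm w * (tau_M M T C ?h + L_M t * ?P * ?h + L_M t * norm w)"
    proof (intro add_mono)
      show "(f t x - f t (y t)) \<bullet> w \<le> l_f t * (norm w)\<^sup>2"
        unfolding w_def by (rule A1_osl[OF t])
    qed (intro order_trans[OF norm_cauchy_schwarz] mult_left_mono f_err p_err norm_ge_zero)+
    also have "\<dots> = (l_f t + L_M t) * (norm w)\<^sup>2 + ?G t * norm w"
      by (simp add: Gamma_err_def algebra_simps power2_eq_square)
    finally show ?thesis by (simp add: w_def k_def)
  qed
  let ?S = "tt ` {..N}"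
  obtain x B where x_0: "x 0 = y 0"
    and x_lip: "\<And>s t. 0 \<le> s \<Longrightarrow> s \<le> t \<Longrightarrow> t \<le> T \<Longrightarrow> norm (x t - x s) \<le> B * (t - s)"
    and x_deriv: "\<And>t. t \<in> {0<..<T} - ?S \<Longrightarrow> (x has_vector_derivative g t (x t)) (at t)"
    and x_bound: "\<And>t. t \<in> {0..T} \<Longrightarrow> norm (x t - y t)
      \<le> integral {0..t} (\<lambda>s. exp (integral {s..t} (\<lambda>s. l_f s + L_M s)) * ?G s)"
  proof (rule dissipative_solution[of 0 T ?S y "\<lambda>t. v (grid_index tt t)" g "\<lambda>s. l_f s + L_M s" ?G])
    show "continuous_on {0..T} y"
      unfolding y_def by (rule continuous_on_polygon[OF grid T_pos Y_Suc])
    show "(y has_vector_derivative v (grid_index tt t)) (at t)" if "t \<in> {0<..<T} - ?S" for t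
      unfolding y_def by (rule has_vector_derivative_polygon[OF grid T_pos that])
    show "continuous_on UNIV (g t)" if t: "t \<in> {0..T}" for t
    proof -
      have "continuous_on UNIV (\<lambda>x. (\<lambda>(t, x). f t x) (t, x))"
        by (rule continuous_on_compose2[OF A1_cont]) (use t in \<open>auto intro!: continuous_intros\<close>)
      moreover have "continuous_on UNIV
          (\<lambda>x. (\<lambda>p. closest_point ((\<lambda>(t, x). M t x) p) (m (grid_index tt t))) (t, x))"
        by (rule continuous_on_compose2[OF proj_cont]) (use t in \<open>auto intro!: continuous_intros\<close>)
      ultimately show ?thesis unfolding g_def by (auto intro: continuous_on_add)
    qed
    show "(\<lambda>s. g s (X s)) integrable_on {0..T}" if "continuous_on {0..T} X" for X
      unfolding g_def
      by (rule piecewise_continuous_integrable[OF grid, of "\<lambda>k s. f s (X s) + closest_point (M s (X s)) (m k)"])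
        (rule piece[OF that])
    show "isCont (\<lambda>s. g s (X s)) t" if "continuous_on {0..T} X" "t \<in> {0<..<T} - ?S" for X t
      unfolding g_def
      by (rule piecewise_continuous_isCont[OF grid T_pos,
            of "\<lambda>k s. f s (X s) + closest_point (M s (X s)) (m k)"])
        (rule piece[OF that(1)], assumption, rule that(2))
    show "\<exists>B. \<forall>t\<in>{0..T}. \<forall>x\<in>cball 0 R. norm (g t x) \<le> B" for R
    proof -
      obtain Bf where Bf: "\<And>t x. t \<in> {0..T} \<Longrightarrow> x \<in> cball 0 R \<Longrightarrow> norm (f t x) \<le> Bf"
        using bounded_on_cylinder[OF A1_cont] by blast
      obtain BM where BM: "\<And>t x. t \<in> {0..T} \<Longrightarrow> x \<in> cball 0 R \<Longrightarrow> norm (set_norm (M t x)) \<le> BM"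
        using set_norm_bounded_on_cylinder[OF A2_cont val] by blast
      have "norm (g t x) \<le> Bf + BM" if tx: "t \<in> {0..T}" "x \<in> cball 0 R" for t x
      proof -
        have "closest_point (M t x) (m (grid_index tt t)) \<in> M t x"
          using val[OF tx(1)] compact_imp_closed closest_point_in_set by blast
        then have "norm (closest_point (M t x) (m (grid_index tt t))) \<le> set_norm (M t x)"
          using val[OF tx(1)] by (intro set_norm_upper) auto
        then show ?thesis
          unfolding g_def using Bf[OF tx] BM[OF tx] by (intro norm_triangle_le) auto
      qed
      then show ?thesis by blast
    qed
    show "continuous_on {0..T} ?G"
      unfolding Gamma_err_def by (intro continuous_intros A2_L_M)
  qed (use T_pos A1_l_f A2_L_M G0 dissip in \<open>auto intro!: continuous_intros\<close>)
  have y_grid: "y (tt n) = Y n" if "n \<le> N" for n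
    unfolding y_def by (rule polygon_at_grid[OF grid T_pos Y_Suc that])

  \<comment> \<open>Verification of the inclusion and of the bound at the grid points\<close>
  have "di_solution (rhs f M) T x0 x"
    unfolding di_solution_def
  proof (intro conjI)
    show "absolutely_continuous_on_interval 0 T x"
      using x_lip by (rule lipschitz_imp_absolutely_continuous)
    show "x 0 = x0"
      using y_grid[of 0] x_0 grid traj by (simp add: is_grid_def euler_trajectory_def)
    show "AE t in lebesgue_on {0..T}.
        \<exists>v. (x has_vector_derivative v) (at t within {0..T}) \<and> v \<in> rhs f M t (x t)"
    proof (rule AE_lebesgue_on_finite_exception[of "?S"])
      fix t assume t: "t \<in> {0..T} - ?S"
      \<comment> \<open>Both end points are grid points, so a time outside \<open>?S\<close> is
        interior and has the two-sided derivative.\<close>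
      have "0 \<in> ?S" "T \<in> ?S" using grid by (force simp: is_grid_def)+
      then have "t \<in> {0<..<T} - ?S" using t by (auto simp: less_le)
      from x_deriv[OF this] have "(x has_vector_derivative g t (x t)) (at t within {0..T})"
        by (rule has_vector_derivative_at_within)
      moreover have "closest_point (M t (x t)) (m (grid_index tt t)) \<in> M t (x t)"
        using val[of t] t compact_imp_closed closest_point_in_set by blast
      then have "g t (x t) \<in> rhs f M t (x t)" by (auto simp: g_def rhs_def)
      ultimately show "\<exists>v. (x has_vector_derivative v) (at t within {0..T}) \<and> v \<in> rhs f M t (x t)"
        by blast
    qed simp
  qed
  moreover have "norm (x (tt n) - Y n) \<le> integral {0..tt n} (\<lambda>t.
      exp (integral {t..tt n} (\<lambda>s. l_f s + L_M s)) * ?G t)" if "n \<le> N" for n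
    using x_bound[OF tt_T[OF that]] y_grid[OF that] by simp
  ultimately show "\<exists>x. di_solution (rhs f M) T x0 x \<and>
      (\<forall>n\<le>N. norm (x (tt n) - Y n) \<le> integral {0..tt n} (\<lambda>t.
         exp (integral {t..tt n} (\<lambda>s. l_f s + L_M s)) * ?G t))"
    by blast
qed

end
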